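(* Let $\kappa>\omega_1$ be regular, and let $\mathcal{S}\subseteq\mathcal{P}([H_\kappa]^\omega)$ be a collection of stationary sets such that $\mathsf{DSRP}(\mathcal{S})$ holds. Then: (1) The principle $\mathsf{wDRP}_{\mathsf{IA}}(\mathcal{S})$ holds: whenever $\theta$ is large enough that $\mathcal{S}\subseteq H_\theta$, there are stationarily many $W\in[H_\theta]^{\omega_1}$ such that (a) $W\cap H_\kappa$ is internally approachable, and (b) for every $S\in W\cap\mathcal{S}$, $S\cap[W\cap H_\kappa]^\omega$ is stationary in $W\cap H_\kappa$. (2) The following slight strengthening of $\mathsf{wDRP}_{\mathsf{IA}}(\mathcal{S})$ holds: whenever $\theta$ is large enough that $\mathcal{S}\subseteq H_\theta$, there are stationarily many $W\in[H_\theta]^{\omega_1}$ such that for every $S\in W\cap\mathcal{S}$ and every regular $\bar\kappa\in W\cap[\omega_2,\kappa]$, $W\cap H_{\bar\kappa}$ is internally approachable and $(S\downarrow H_{\bar\kappa})\cap[W\cap H_{\bar\kappa}]^\omega$ is stationary in $W\cap H_{\bar\kappa}$.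
   Context: $H_\chi$ is the set of all sets whose transitive closure has cardinality less than $\chi$. $[Y]^\omega$ is the set of countable subsets of $Y$, and $[Y]^{\omega_1}$ is the set of subsets of $Y$ of size $\omega_1$. A set $R\subseteq[Y]^\omega$ is stationary in $Y$ if it meets every closed unbounded subset of $[Y]^\omega$; likewise, a subset of $[Y]^{\omega_1}$ is stationary in $Y$ if it meets every closed unbounded subset of $[Y]^{\omega_1}$, and "stationarily many" is understood in this sense. For $S\subseteq[H_\kappa]^\omega$ and $\bar\kappa\le\kappa$, $S\downarrow H_{\bar\kappa}=\{x\cap H_{\bar\kappa}\mid x\in S\}$. A set $N$ is internally approachable if it is the union of an $\in$-chain (a sequence increasing with respect to $\in$) $\langle N_\alpha\mid\alpha<\omega_1\rangle$ such that for every $\alpha<\omega_1$, $\langle N_\xi\mid\xi<\alpha\rangle\in N$. A sequence $\vec{Q}=\langle Q_i\mid i<\omega_1\rangle$ is a diagonal chain through $\mathcal{S}$ up to a set $X$ if: (i) $\vec{Q}$ is a continuous $\in$-chain of countable subsets of $H_\kappa$ ($Q_i\in Q_{i+1}$ for all $i<\omega_1$, and $Q_\lambda=\bigcup_{i<\lambda}Q_i$ for limit $\lambda<\omega_1$); (ii) for every $S\in X\cap\mathcal{S}$, the set $\{i<\omega_1\mid Q_i\in S\}$ is stationary in $\omega_1$; (iii) $H_\kappa\cap X=\bigcup_{i<\omega_1}Q_i$, and for all $\alpha<\omega_1$, $\langle Q_i\mid i<\alpha\rangle\in H_\kappa\cap X$. $\mathsf{DSRP}(\mathcal{S})$ says that,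 for $\theta$ a sufficiently large regular cardinal (so that $\mathcal{S}\subseteq H_\theta$, that is, $\theta>2^{<\kappa}$), the set of $X\in[H_\theta]^{\omega_1}$ such that $\omega_1\subseteq X$ and there is a diagonal chain through $\mathcal{S}$ up to $X$ is stationary in $H_\theta$. *)

theory Defs
  imports "HOL-Library.Equipollence" "HOL-Library.Countable_Set"
begin

text \<open>
  A universe of ZFC sets. As usual for set theory inside HOL, Separation and Replacement range
  over arbitrary HOL predicates and functions; the Axiom of Choice then follows from Hilbert choice.
\<close>

class zfc_universe =
  fixes elts :: "'a \<Rightarrow> 'a set"
  assumes extensionality: "elts x = elts y \<Longrightarrow> x = y"
    and foundation: "wf {(x, y). x \<in> elts y}"
    and pairing: "\<exists>z. elts z = {x, y}"
    and union: "\<exists>u. elts u = \<Union> (elts ` elts x)"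
    and power_set: "\<exists>p. elts p = {y. elts y \<subseteq> elts x}"
    and infinity: "\<exists>w. (\<exists>e \<in> elts w. elts e = {}) \<and>
                       (\<forall>x \<in> elts w. \<exists>y \<in> elts w. elts y = insert x (elts x))"
    and separation: "\<exists>z. elts z = {y \<in> elts x. P y}"
    and replacement: "\<exists>z. elts z = F ` elts x"

text \<open>
  Throughout, a HOL set of type \<open>'v set\<close> stands for a set or class of the universe, and
  \<open>mk A\<close> is the element of the universe with extension \<open>A\<close> (meaningful if \<open>A\<close> is not a proper class).
\<close>

definition mk :: "'v::zfc_universe set \<Rightarrow> 'v" where
  "mk A = (THE x. elts x = A)"

definition pair :: "'v::zfc_universe \<Rightarrow> 'v \<Rightarrow> 'v" where
  "pair x y = mk {mk {x}, mk {x, y}}"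

text \<open>The sequence \<open>\<langle>Q\<^sub>i | i < \<alpha>\<rangle>\<close> as an element of the universe.\<close>

definition seq :: "('v::zfc_universe \<Rightarrow> 'v) \<Rightarrow> 'v \<Rightarrow> 'v" where
  "seq Q \<alpha> = mk ((\<lambda>i. pair i (Q i)) ` elts \<alpha>)"

subsection \<open>Ordinals and cardinals\<close>

definition transitive :: "'v::zfc_universe \<Rightarrow> bool" where
  "transitive x \<longleftrightarrow> (\<forall>y \<in> elts x. elts y \<subseteq> elts x)"

definition Ord :: "'v::zfc_universe \<Rightarrow> bool" where
  "Ord \<alpha> \<longleftrightarrow> transitive \<alpha> \<and> (\<forall>\<beta> \<in> elts \<alpha>. transitive \<beta>)"

definition succ :: "'v::zfc_universe \<Rightarrow> 'v" where
  "succ \<alpha> = mk (insert \<alpha> (elts \<alpha>))"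

definition Limit :: "'v::zfc_universe \<Rightarrow> bool" where
  "Limit \<delta> \<longleftrightarrow> Ord \<delta> \<and> elts \<delta> \<noteq> {} \<and> (\<forall>\<alpha> \<in> elts \<delta>. succ \<alpha> \<in> elts \<delta>)"

definition Card :: "'v::zfc_universe \<Rightarrow> bool" where
  "Card \<kappa> \<longleftrightarrow> Ord \<kappa> \<and> (\<forall>\<alpha> \<in> elts \<kappa>. elts \<alpha> \<prec> elts \<kappa>)"

definition regular :: "'v::zfc_universe \<Rightarrow> bool" where
  "regular \<kappa> \<longleftrightarrow> Card \<kappa> \<and> infinite (elts \<kappa>) \<and>
     (\<forall>A \<subseteq> elts \<kappa>. A \<prec> elts \<kappa> \<longrightarrow> (\<exists>\<beta> \<in> elts \<kappa>. \<forall>\<alpha> \<in> A. \<alpha> \<in> elts \<beta>))"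

definition omega :: "'v::zfc_universe" where
  "omega = mk {\<alpha>. Ord \<alpha> \<and> finite (elts \<alpha>)}"

definition card_succ :: "'v::zfc_universe \<Rightarrow> 'v" where
  "card_succ \<kappa> = mk {\<alpha>. Ord \<alpha> \<and> elts \<alpha> \<lesssim> elts \<kappa>}"

definition omega1 :: "'v::zfc_universe" where
  "omega1 = card_succ omega"

definition omega2 :: "'v::zfc_universe" where
  "omega2 = card_succ omega1"

text \<open>The cardinal \<open>2\<^bsup><\<kappa>\<^esup>\<close>, the supremum of the \<open>2\<^bsup>\<mu>\<^esup>\<close> for \<open>\<mu> < \<kappa>\<close>: an ordinal \<open>\<alpha>\<close> lies below it
  iff \<open>|\<alpha>| < 2\<^bsup>|\<mu>|\<^esup>\<close> for some \<open>\<mu> < \<kappa>\<close>.\<close>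

definition two_pow_below :: "'v::zfc_universe \<Rightarrow> 'v" where
  "two_pow_below \<kappa> = mk {\<alpha>. Ord \<alpha> \<and> (\<exists>\<mu> \<in> elts \<kappa>. elts \<alpha> \<prec> Pow (elts \<mu>))}"

definition trans_closure :: "'v::zfc_universe \<Rightarrow> 'v set" where
  "trans_closure x = {y. (y, x) \<in> {(u, v). u \<in> elts v}\<^sup>+}"

definition H :: "'v::zfc_universe \<Rightarrow> 'v set" where
  "H \<chi> = {x. trans_closure x \<prec> elts \<chi>}"

subsection \<open>Closed unbounded and stationary sets\<close>

definition ctbl_subsets :: "'v::zfc_universe set \<Rightarrow> 'v set set" where
  "ctbl_subsets Y = {x. x \<subseteq> Y \<and> countable x}"

definition omega1_subsets :: "'v::zfc_universe set \<Rightarrow> 'v set set" where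
  "omega1_subsets Y = {x. x \<subseteq> Y \<and> x \<approx> elts (omega1 :: 'v)}"

text \<open>\<open>C\<close> is closed unbounded in \<open>P\<close>, where closure refers to unions of nonempty increasing
  sequences of ordinal length of cardinality at most \<open>\<nu>\<close>.\<close>

definition club :: "'v::zfc_universe \<Rightarrow> 'v set set \<Rightarrow> 'v set set \<Rightarrow> bool" where
  "club \<nu> P C \<longleftrightarrow> C \<subseteq> P \<and> (\<forall>x \<in> P. \<exists>y \<in> C. x \<subseteq> y) \<and>
     (\<forall>(\<alpha>::'v) D. Ord \<alpha> \<and> elts \<alpha> \<noteq> {} \<and> elts \<alpha> \<lesssim> elts \<nu> \<and> (\<forall>\<xi> \<in> elts \<alpha>. D \<xi> \<in> C) \<and>
        (\<forall>\<eta> \<in> elts \<alpha>. \<forall>\<xi> \<in> elts \<eta>. D \<xi> \<subseteq> D \<eta>) \<longrightarrow> (\<Union>\<xi> \<in> elts \<alpha>. D \<xi>) \<in> C)"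

definition stationary_ctbl :: "'v::zfc_universe set \<Rightarrow> 'v set set \<Rightarrow> bool" where
  "stationary_ctbl Y R \<longleftrightarrow> R \<subseteq> ctbl_subsets Y \<and>
     (\<forall>C. club omega (ctbl_subsets Y) C \<longrightarrow> R \<inter> C \<noteq> {})"

definition stationary_omega1 :: "'v::zfc_universe set \<Rightarrow> 'v set set \<Rightarrow> bool" where
  "stationary_omega1 Y R \<longleftrightarrow> R \<subseteq> omega1_subsets Y \<and>
     (\<forall>C. club omega1 (omega1_subsets Y) C \<longrightarrow> R \<inter> C \<noteq> {})"

definition club_ord :: "'v::zfc_universe \<Rightarrow> 'v set \<Rightarrow> bool" where
  "club_ord \<mu> C \<longleftrightarrow> C \<subseteq> elts \<mu> \<and> (\<forall>\<alpha> \<in> elts \<mu>. \<exists>\<beta> \<in> C. \<alpha> \<in> elts \<beta>) \<and>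
     (\<forall>\<delta> \<in> elts \<mu>. Limit \<delta> \<and> (\<forall>\<alpha> \<in> elts \<delta>. \<exists>\<beta> \<in> C \<inter> elts \<delta>. \<alpha> \<in> elts \<beta>) \<longrightarrow> \<delta> \<in> C)"

definition stationary_ord :: "'v::zfc_universe \<Rightarrow> 'v set \<Rightarrow> bool" where
  "stationary_ord \<mu> A \<longleftrightarrow> A \<subseteq> elts \<mu> \<and> (\<forall>C. club_ord \<mu> C \<longrightarrow> A \<inter> C \<noteq> {})"

text \<open>The family of subsets of the universe coded by an element \<open>S\<close> of the universe.\<close>

definition family :: "'v::zfc_universe \<Rightarrow> 'v set set" where
  "family S = elts ` elts S"

definition restrict_family :: "'v set set \<Rightarrow> 'v set \<Rightarrow> 'v set set" (infixl \<open>\<down>\<close> 75) where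
  "R \<down> Z = {x \<inter> Z | x. x \<in> R}"

subsection \<open>Diagonal chains and reflection principles\<close>

definition internally_approachable :: "'v::zfc_universe set \<Rightarrow> bool" where
  "internally_approachable N \<longleftrightarrow>
     (\<exists>M :: 'v \<Rightarrow> 'v. (\<forall>\<beta> \<in> elts omega1. \<forall>\<alpha> \<in> elts \<beta>. M \<alpha> \<in> elts (M \<beta>)) \<and>
          N = (\<Union>\<alpha> \<in> elts omega1. elts (M \<alpha>)) \<and>
          (\<forall>\<alpha> \<in> elts omega1. seq M \<alpha> \<in> N))"

definition diagonal_chain ::
    "'v::zfc_universe \<Rightarrow> 'v set \<Rightarrow> 'v set \<Rightarrow> ('v \<Rightarrow> 'v) \<Rightarrow> bool" where
  "diagonal_chain \<kappa> \<S> X Q \<longleftrightarrow>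
     (\<forall>i \<in> elts omega1. elts (Q i) \<in> ctbl_subsets (H \<kappa>)) \<and>
     (\<forall>i \<in> elts omega1. Q i \<in> elts (Q (succ i))) \<and>
     (\<forall>l \<in> elts omega1. Limit l \<longrightarrow> elts (Q l) = (\<Union>i \<in> elts l. elts (Q i))) \<and>
     (\<forall>S \<in> X \<inter> \<S>. stationary_ord omega1 {i \<in> elts omega1. Q i \<in> elts S}) \<and>
     H \<kappa> \<inter> X = (\<Union>i \<in> elts omega1. elts (Q i)) \<and>
     (\<forall>\<alpha> \<in> elts omega1. seq Q \<alpha> \<in> H \<kappa> \<inter> X)"

text \<open>If \<open>\<S>\<close> is a nonempty collection of stationary subsets of \<open>[H\<^sub>\<kappa>]\<^sup>\<omega>\<close>, the two conditions
  are equivalent; for empty \<open>\<S>\<close> only the second one makes \<open>\<theta>\<close> large.\<close>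

definition large_enough :: "'v::zfc_universe \<Rightarrow> 'v set \<Rightarrow> 'v \<Rightarrow> bool" where
  "large_enough \<kappa> \<S> \<theta> \<longleftrightarrow> Card \<theta> \<and> \<S> \<subseteq> H \<theta> \<and> two_pow_below \<kappa> \<in> elts \<theta>"

definition DSRP :: "'v::zfc_universe \<Rightarrow> 'v set \<Rightarrow> bool" where
  "DSRP \<kappa> \<S> \<longleftrightarrow> (\<forall>\<theta>. regular \<theta> \<and> large_enough \<kappa> \<S> \<theta> \<longrightarrow>
     stationary_omega1 (H \<theta>)
       {X \<in> omega1_subsets (H \<theta>). elts omega1 \<subseteq> X \<and> (\<exists>Q. diagonal_chain \<kappa> \<S> X Q)})"

definition wDRP_IA :: "'v::zfc_universe \<Rightarrow> 'v set \<Rightarrow> bool" where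
  "wDRP_IA \<kappa> \<S> \<longleftrightarrow> (\<forall>\<theta>. large_enough \<kappa> \<S> \<theta> \<longrightarrow>
     stationary_omega1 (H \<theta>)
       {W \<in> omega1_subsets (H \<theta>).
          internally_approachable (W \<inter> H \<kappa>) \<and>
          (\<forall>S \<in> W \<inter> \<S>. stationary_ctbl (W \<inter> H \<kappa>) (family S \<inter> ctbl_subsets (W \<inter> H \<kappa>)))})"

end

theory Submission imports Defs begin

text \<open>
  Why the theorem holds. Let \<open>X\<close> be one of the sets provided by \<open>DSRP\<close>, with a diagonal chain \<open>Q\<close>
  up to \<open>X\<close>, and let \<open>W = X \<inter> H \<theta>\<close> with \<open>\<theta> \<ge> \<kappa>\<close>. Then \<open>W \<inter> H \<kappa> = \<Union>\<^sub>i Q i\<close>.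

  Stationarity. Let \<open>C\<close> be a club of countable subsets of \<open>W \<inter> H \<kappa>\<close>. As \<open>Q\<close> is continuous, the indices
  \<open>i\<close> with \<open>Q i \<in> C\<close> contain a club of \<open>\<omega>\<^sub>1\<close> (\<open>club_ord_chain\<close>), and for \<open>S \<in> W \<inter> \<S>\<close> the indices
  with \<open>Q i \<in> S\<close> are stationary. So some \<open>Q i\<close> is in \<open>S \<inter> C\<close>. For \<open>\<kappa>' < \<kappa>\<close>, a club of countable
  subsets of \<open>W \<inter> H \<kappa>'\<close> lifts to \<open>W \<inter> H \<kappa>\<close> along \<open>x \<mapsto> x \<inter> H \<kappa>'\<close>, so the traces of the elements of \<open>S\<close>
  are stationary there (\<open>stationary_ctbl_restrict\<close>).

  Internal approachability. The chain \<open>Q\<close> cannot be used directly, because \<open>Q i \<in> Q j\<close> may fail for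
  some \<open>i < j\<close>, and its traces on \<open>H \<kappa>'\<close> need not be elements of one another. Instead one takes
  \<open>M \<alpha> = ((\<Union>i<\<alpha>. Q i) \<inter> H \<kappa>') \<union> {M \<beta> | \<beta> < \<alpha>}\<close>, which is an \<open>\<in>\<close>-chain by construction. Both
  \<open>M \<alpha>\<close> and \<open>\<langle>M \<beta> | \<beta> < \<alpha>\<rangle>\<close> are determined by \<open>\<kappa>'\<close> and \<open>\<langle>Q i | i < \<alpha>\<rangle>\<close>, which is an element of \<open>X\<close>.
  So they are in \<open>X\<close> as soon as \<open>X\<close> is closed under one operation with countable values
  (\<open>approx_codes\<close>), and such \<open>X\<close> form a club (\<open>club_closed_under\<close>). They also are in \<open>H \<kappa>'\<close>, which is closed
  under countable subsets, and hence the union of the \<open>M \<alpha>\<close> is exactly \<open>W \<inter> H \<kappa>'\<close>.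

  Every \<open>\<theta>\<close>, regular or not, is reached from the regular cardinal \<open>\<theta>\<^sup>+\<close>: clubs lift along the trace on
  \<open>H \<theta>\<close> (\<open>club_lift\<close>), and \<open>\<kappa> \<le> 2\<^bsup><\<kappa>\<^esup> < \<theta>\<close> guarantees that the traces on \<open>H \<kappa>'\<close> do not change.
\<close>

section \<open>Cardinality of classes\<close>

unbundle cardinal_syntax

lemma lepoll_iff_ordLeq: "A \<lesssim> B \<longleftrightarrow> |A| \<le>o |B|"
  by (simp add: lepoll_def card_of_ordLeq)

lemma lesspoll_iff_ordLess: "A \<prec> B \<longleftrightarrow> |A| <o |B|"
proof -
  have "A \<prec> B \<longleftrightarrow> \<not> B \<lesssim> A"
    by (metis lepoll_iff_leqpoll lepoll_iff_ordLeq lesspoll_not_refl lesspoll_trans1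
        card_of_Well_order ordLess_or_ordLeq ordLess_imp_ordLeq eqpoll_imp_lepoll eqpoll_sym)
  then show ?thesis
    by (simp add: lepoll_iff_ordLeq not_ordLeq_iff_ordLess card_of_Well_order)
qed

lemma not_lepoll_iff_lesspoll: "\<not> B \<lesssim> A \<longleftrightarrow> A \<prec> B"
  by (simp add: lepoll_iff_ordLeq lesspoll_iff_ordLess not_ordLeq_iff_ordLess card_of_Well_order)

lemma UN_lepoll_infinite:
  assumes "infinite B" "A \<lesssim> B" "\<And>a. a \<in> A \<Longrightarrow> f a \<lesssim> B"
  shows "(\<Union>a\<in>A. f a) \<lesssim> B"
  using assms card_of_UNION_ordLeq_infinite[of B A f] by (simp add: lepoll_iff_ordLeq)

lemma Un_lepoll_infinite:
  assumes "infinite B" "A \<lesssim> B" "A' \<lesssim> B"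
  shows "A \<union> A' \<lesssim> B"
  using assms card_of_Un_ordLeq_infinite_Field[of "|B|" A A'] 
  by (simp add: lepoll_iff_ordLeq card_of_card_order_on Field_card_of)

lemma Un_lesspoll_infinite:
  assumes "infinite B" "A \<prec> B" "A' \<prec> B"
  shows "A \<union> A' \<prec> B"
  using assms card_of_Un_ordLess_infinite[of B A A'] by (simp add: lesspoll_iff_ordLess)

lemma Times_lepoll_infinite:
  assumes "infinite C" "A \<lesssim> C" "B \<lesssim> C"
  shows "A \<times> B \<lesssim> C"
  using assms card_of_Times_ordLeq_infinite_Field[of "|C|" A B]
  by (simp add: lepoll_iff_ordLeq card_of_card_order_on Field_card_of)

lemma Times_lesspoll_infinite:
  assumes "infinite C" "A \<prec> C" "B \<prec> C"
  shows "A \<times> B \<prec> C"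
proof (cases "finite A \<and> finite B")
  case True
  then show ?thesis
    using assms(1) by (simp add: finite_lesspoll_infinite)
next
  case False
  have "A \<times> B \<lesssim> A \<or> A \<times> B \<lesssim> B"
  proof (cases "A \<lesssim> B")
    case True
    with False have "infinite B"
      by (meson infinite_le_lepoll lepoll_trans)
    with True show ?thesis
      by (simp add: Times_lepoll_infinite)
  next
    assume "\<not> A \<lesssim> B"
    then have BA: "B \<lesssim> A"
      using not_lepoll_iff_lesspoll lesspoll_imp_lepoll by blast
    with False have "infinite A"
      by (meson infinite_le_lepoll lepoll_trans)
    with BA show ?thesis
      by (simp add: Times_lepoll_infinite)
  qed
  then show ?thesis
    using lesspoll_trans1[OF _ assms(2)] lesspoll_trans1[OF _ assms(3)] by blast
qed

section \<open>Sets and classes\<close>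

text \<open>
  Only the classes that are extensions of elements of the universe are accessible to \<open>mk\<close>; by
  Separation and Replacement a class that injects into one of them is again one of them.
\<close>

definition is_set :: "'v::zfc_universe set \<Rightarrow> bool" where
  "is_set A \<longleftrightarrow> (\<exists>x. elts x = A)"

lemma elts_inject [simp]: "elts x = elts y \<longleftrightarrow> x = y"
  by (auto intro: extensionality)

lemma elts_mk [simp]: "is_set A \<Longrightarrow> elts (mk A) = A"
proof -
  assume "is_set A"
  then obtain x where "elts x = A" unfolding is_set_def by blast
  then show ?thesis unfolding mk_def by (metis (mono_tags, lifting) theI extensionality)
qed

lemma is_set_elts [simp]: "is_set (elts x)"
  unfolding is_set_def by blast

lemma is_set_subset: "is_set B \<Longrightarrow> A \<subseteq> B \<Longrightarrow> is_set A"
proof -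
  assume "is_set B" "A \<subseteq> B"
  then obtain x where x: "elts x = B" unfolding is_set_def by blast
  obtain z where "elts z = {y \<in> elts x. y \<in> A}" using separation[of x "\<lambda>y. y \<in> A"] by blast
  also have "\<dots> = A" using x \<open>A \<subseteq> B\<close> by blast
  finally show ?thesis unfolding is_set_def by blast
qed

lemma is_set_image [simp]: "is_set A \<Longrightarrow> is_set (f ` A)"
  for A :: "'v::zfc_universe set" and f :: "'v \<Rightarrow> 'v"
  using replacement[of f] by (auto simp: is_set_def)

lemma is_set_lepoll: "is_set B \<Longrightarrow> A \<lesssim> B \<Longrightarrow> is_set A"
  for A B :: "'v::zfc_universe set"
  unfolding lepoll_iff using is_set_subset is_set_image by blast

lemma is_set_UN [simp]: "is_set A \<Longrightarrow> is_set (\<Union>x\<in>A. elts (f x))"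
  for A :: "'v::zfc_universe set" and f :: "'v \<Rightarrow> 'v"
proof -
  assume "is_set A"
  then obtain x where "elts x = f ` A"
    using is_set_image[of A f] unfolding is_set_def by blast
  then show ?thesis using union[of x] unfolding is_set_def by (metis image_image)
qed

lemma is_set_pair: "is_set {x, y}"
  using pairing unfolding is_set_def by blast

lemma is_set_Un [simp]: "is_set A \<Longrightarrow> is_set B \<Longrightarrow> is_set (A \<union> B)"
proof -
  assume "is_set A" "is_set B"
  then have "A \<union> B = (\<Union>x\<in>{mk A, mk B}. elts x)" by auto
  then show ?thesis using is_set_UN[OF is_set_pair, of "\<lambda>x. x"] by metis
qed

lemma is_set_empty [simp]: "is_set {}"
  using is_set_subset is_set_elts by blast

lemma is_set_insert [simp]: "is_set A \<Longrightarrow> is_set (insert x A)"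
  by (metis insert_is_Un is_set_Un is_set_pair insert_absorb2)

lemma is_set_subsets: "is_set {y. elts y \<subseteq> elts x}"
  using power_set unfolding is_set_def by blast

lemma Pow_elts_lepoll: "Pow (elts x) \<lesssim> elts (mk {y. elts y \<subseteq> elts x})" for x :: "'v::zfc_universe"
proof (rule subset_image_lepoll)
  show "Pow (elts x) \<subseteq> elts ` elts (mk {y. elts y \<subseteq> elts x})"
  proof
    fix B assume "B \<in> Pow (elts x)"
    then have "elts (mk B) = B"
      using is_set_subset[OF is_set_elts, of B x] by simp
    with \<open>B \<in> Pow (elts x)\<close> show "B \<in> elts ` elts (mk {y. elts y \<subseteq> elts x})"
      by (intro image_eqI[of _ _ "mk B"]) (auto simp: is_set_subsets)
  qed
qed

lemma elts_succ [simp]: "elts (succ \<alpha>) = insert \<alpha> (elts \<alpha>)"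
  by (simp add: succ_def)

lemma elts_induct: "(\<And>x. (\<And>y. y \<in> elts x \<Longrightarrow> P y) \<Longrightarrow> P x) \<Longrightarrow> P x" for x :: "'v::zfc_universe"
  using wf_induct[OF foundation, of P x] by auto

lemma mem_not_sym: "x \<in> elts y \<Longrightarrow> y \<notin> elts x" for x :: "'v::zfc_universe"
  using wf_asym[OF foundation, of x y] by auto

lemma mem_not_refl [simp]: "x \<notin> elts x" for x :: "'v::zfc_universe"
  using mem_not_sym by blast

lemma pair_inject [simp]: "pair a b = pair c d \<longleftrightarrow> a = c \<and> b = d"
  for a b c d :: "'v::zfc_universe"
proof -
  have [simp]: "mk A = mk B \<longleftrightarrow> A = B" if "is_set A" "is_set B" for A B :: "'v set"
    using that by (metis elts_mk)
  show ?thesis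
    unfolding pair_def by (simp add: doubleton_eq_iff) auto
qed

lemma elts_seq [simp]: "elts (seq Q \<alpha>) = (\<lambda>i. pair i (Q i)) ` elts \<alpha>"
  by (simp add: seq_def)

text \<open>
  A sequence remembers its length and its entries: anything computed from the entries is a function
  of the coded sequence. This makes \<open>approx_codes\<close> below have few elements.
\<close>

lemma seq_eqD: "seq Q \<alpha> = seq Q' \<beta> \<Longrightarrow> \<alpha> = \<beta> \<and> (\<forall>i\<in>elts \<alpha>. Q i = Q' i)"
proof -
  assume "seq Q \<alpha> = seq Q' \<beta>"
  then have *: "(\<lambda>i. pair i (Q i)) ` elts \<alpha> = (\<lambda>i. pair i (Q' i)) ` elts \<beta>"
    by (metis elts_seq)
  have "elts \<alpha> = elts \<beta>"
  proof (intro equalityI subsetI)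
    fix i assume "i \<in> elts \<alpha>" then have "pair i (Q i) \<in> (\<lambda>i. pair i (Q' i)) ` elts \<beta>" using * by blast
    then show "i \<in> elts \<beta>" by auto
  next
    fix i assume "i \<in> elts \<beta>" then have "pair i (Q' i) \<in> (\<lambda>i. pair i (Q i)) ` elts \<alpha>" using * by blast
    then show "i \<in> elts \<alpha>" by auto
  qed
  moreover have "Q i = Q' i" if "i \<in> elts \<alpha>" for i
  proof -
    have "pair i (Q i) \<in> (\<lambda>i. pair i (Q' i)) ` elts \<beta>" using * that by blast
    then show ?thesis by auto
  qed
  ultimately show ?thesis by simp
qed

section \<open>Ordinals\<close>

lemma Ord_in_Ord: "Ord \<alpha> \<Longrightarrow> \<beta> \<in> elts \<alpha> \<Longrightarrow> Ord \<beta>"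
  unfolding Ord_def transitive_def by blast

lemma Ord_transD: "Ord \<alpha> \<Longrightarrow> \<beta> \<in> elts \<alpha> \<Longrightarrow> \<gamma> \<in> elts \<beta> \<Longrightarrow> \<gamma> \<in> elts \<alpha>"
  unfolding Ord_def transitive_def by blast

lemma OrdI: "\<lbrakk>\<And>\<beta> \<gamma>. \<beta> \<in> elts \<alpha> \<Longrightarrow> \<gamma> \<in> elts \<beta> \<Longrightarrow> \<gamma> \<in> elts \<alpha>; \<And>\<beta>. \<beta> \<in> elts \<alpha> \<Longrightarrow> Ord \<beta>\<rbrakk> \<Longrightarrow> Ord \<alpha>"
  unfolding Ord_def transitive_def by blast

lemma Ord_succ: "Ord \<alpha> \<Longrightarrow> Ord (succ \<alpha>)"
  by (rule OrdI) (auto intro: Ord_transD Ord_in_Ord)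

lemma Ord_linear:
  assumes "Ord \<alpha>" "Ord \<beta>"
  shows "\<alpha> \<in> elts \<beta> \<or> \<alpha> = \<beta> \<or> \<beta> \<in> elts \<alpha>"
  using assms
proof (induction \<alpha> arbitrary: \<beta> rule: elts_induct)
  case (1 \<alpha>)
  note outer = 1
  from outer(3) show ?case
  proof (induction \<beta> rule: elts_induct)
    case (1 \<beta>)
    show ?case
    proof (rule ccontr)
      assume no: "\<not> ?case"
      have "elts \<alpha> \<subseteq> elts \<beta>"
        using outer(1)[of _ \<beta>] outer(2) 1(2) no by (metis Ord_in_Ord Ord_transD subsetI)
      moreover have "elts \<beta> \<subseteq> elts \<alpha>"
        using 1(1) outer(2) 1(2) no by (metis Ord_in_Ord Ord_transD subsetI)
      ultimately show False using no by auto
    qed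
  qed
qed

lemma Ord_subset_iff: "Ord \<alpha> \<Longrightarrow> Ord \<beta> \<Longrightarrow> elts \<alpha> \<subseteq> elts \<beta> \<longleftrightarrow> \<alpha> \<in> elts \<beta> \<or> \<alpha> = \<beta>"
  using Ord_linear Ord_transD mem_not_refl by (metis subset_iff)

subsection \<open>Finite ordinals\<close>

lemma finite_Ord_cases:
  assumes "Ord \<alpha>" "finite (elts \<alpha>)"
  obtains "elts \<alpha> = {}" | \<beta> where "\<beta> \<in> elts \<alpha>" "\<alpha> = succ \<beta>"
proof (cases "elts \<alpha> = {}")
  case False
  have "Max ((\<lambda>\<gamma>. card (elts \<gamma>)) ` elts \<alpha>) \<in> (\<lambda>\<gamma>. card (elts \<gamma>)) ` elts \<alpha>"
    using False assms(2) by (intro Max_in) auto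
  then obtain \<beta> where "\<beta> \<in> elts \<alpha>" "card (elts \<beta>) = Max ((\<lambda>\<gamma>. card (elts \<gamma>)) ` elts \<alpha>)"
    by force
  then have \<beta>: "\<beta> \<in> elts \<alpha>" "\<And>\<gamma>. \<gamma> \<in> elts \<alpha> \<Longrightarrow> card (elts \<gamma>) \<le> card (elts \<beta>)"
    using assms(2) by auto
  have "\<gamma> \<in> elts (succ \<beta>)" if "\<gamma> \<in> elts \<alpha>" for \<gamma>
  proof (rule ccontr)
    assume "\<gamma> \<notin> elts (succ \<beta>)"
    then have "\<beta> \<in> elts \<gamma>"
      using Ord_linear[of \<gamma> \<beta>] assms(1) that \<beta>(1) Ord_in_Ord by auto
    moreover have "elts \<gamma> \<subseteq> elts \<alpha>"
      using assms(1) that Ord_transD by blast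
    ultimately have "elts \<beta> \<subset> elts \<gamma>"
      using assms(1) that Ord_in_Ord Ord_transD mem_not_refl[of \<beta>] by blast
    then have "card (elts \<beta>) < card (elts \<gamma>)"
      using \<open>elts \<gamma> \<subseteq> elts \<alpha>\<close> assms(2) by (meson finite_subset psubset_card_mono)
    then show False
      using \<beta>(2)[OF that] by simp
  qed
  then have "\<alpha> = succ \<beta>"
    using \<beta>(1) assms(1) Ord_transD by (intro extensionality) auto
  with \<beta>(1) show thesis
    using that by blast
qed

text \<open>
  The set given by the axiom of infinity need not consist of ordinals, but every finite ordinal is
  the empty set or a successor and so belongs to it.
\<close>

lemma elts_omega [simp]: "elts (omega :: 'v::zfc_universe) = {\<alpha>. Ord \<alpha> \<and> finite (elts \<alpha>)}"
proof -
  obtain w e :: 'v where e: "e \<in> elts w" "elts e = {}" 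
    and w: "\<And>x. x \<in> elts w \<Longrightarrow> \<exists>y\<in>elts w. elts y = insert x (elts x)"
    using infinity[where ?'a = 'v] by blast
  have "\<alpha> \<in> elts w" if "Ord \<alpha>" "finite (elts \<alpha>)" for \<alpha>
    using that
  proof (induction \<alpha> rule: elts_induct)
    case (1 \<alpha>)
    from 1(2,3) show ?case
    proof (cases rule: finite_Ord_cases)
      case 1
      then show ?thesis using e by (metis elts_inject)
    next
      case (2 \<beta>)
      then have "\<beta> \<in> elts w"
        using "1.IH"[of \<beta>] 1(2,3) Ord_in_Ord[OF 1(2), of \<beta>] by auto
      with w obtain y where "y \<in> elts w" "elts y = elts \<alpha>"
        using 2(2) by auto
      then show ?thesis by simp
    qed
  qed
  then have "is_set {\<alpha> :: 'v. Ord \<alpha> \<and> finite (elts \<alpha>)}"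
    by (intro is_set_subset[OF is_set_elts[of w]]) blast
  then show ?thesis
    by (simp add: omega_def)
qed

lemma card_elts_omega: "bij_betw (\<lambda>\<alpha>. card (elts \<alpha>)) (elts (omega :: 'v::zfc_universe)) (UNIV :: nat set)"
proof -
  have "inj_on (\<lambda>\<alpha>. card (elts \<alpha>)) (elts (omega :: 'v))"
  proof (rule inj_onI, rule ccontr)
    fix \<alpha> \<beta> :: 'v
    assume a: "\<alpha> \<in> elts omega" "\<beta> \<in> elts omega" "card (elts \<alpha>) = card (elts \<beta>)" "\<alpha> \<noteq> \<beta>"
    then have "elts \<alpha> \<subset> elts \<beta> \<or> elts \<beta> \<subset> elts \<alpha>"
      using Ord_linear[of \<alpha> \<beta>] Ord_subset_iff[of \<alpha> \<beta>] Ord_subset_iff[of \<beta> \<alpha>]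
      by (auto simp: psubset_eq)
    then show False
      using a psubset_card_mono by (metis (mono_tags, lifting) elts_omega less_irrefl mem_Collect_eq)
  qed
  moreover have "\<exists>\<alpha> \<in> elts (omega :: 'v). card (elts \<alpha>) = n" for n
  proof (induction n)
    case 0
    show ?case by (intro bexI[of _ "mk {}"]) (auto intro: OrdI)
  next
    case (Suc n)
    then obtain \<alpha> :: 'v where "\<alpha> \<in> elts omega" "card (elts \<alpha>) = n" by blast
    then show ?case by (intro bexI[of _ "succ \<alpha>"]) (auto intro: Ord_succ)
  qed
  ultimately show ?thesis
    unfolding bij_betw_def by (auto simp: image_iff set_eq_iff eq_commute)
qed

lemma infinite_omega: "infinite (elts omega)"
  using card_elts_omega bij_betw_finite by blast

section \<open>Regular cardinals\<close>

lemma Ord_unbounded_cover: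
  assumes "\<And>\<alpha>. \<alpha> \<in> A \<union> U \<Longrightarrow> Ord \<alpha>" "\<not> (\<exists>\<beta>\<in>U. A \<subseteq> elts \<beta>)"
  shows "U \<subseteq> (\<Union>a\<in>A. elts (succ a))"
proof
  fix \<beta> assume "\<beta> \<in> U"
  moreover from this obtain a where "a \<in> A" "a \<notin> elts \<beta>"
    using assms(2) by blast
  ultimately show "\<beta> \<in> (\<Union>a\<in>A. elts (succ a))"
    using Ord_linear[of a \<beta>] assms(1) by auto
qed

lemma succ_lepoll: "infinite B \<Longrightarrow> elts \<alpha> \<lesssim> B \<Longrightarrow> elts (succ \<alpha>) \<lesssim> B"
  using Un_lepoll_infinite[of B "{\<alpha>}" "elts \<alpha>"] finite_lepoll_infinite[of B "{\<alpha>}"] by simp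

text \<open>
  Hartogs' theorem. The counting argument avoids order types: let \<open>q \<supseteq> x\<close> be infinite and \<open>p\<close> its
  power set. A copy of \<open>p\<close> inside the class \<open>U\<close> of ordinals \<open>\<alpha> \<lesssim> q\<close> cannot lie below one
  element of \<open>U\<close>, by Cantor's theorem, so it is cofinal in \<open>U\<close>; but then \<open>U\<close> is a union of \<open>p\<close> many
  sets of size at most \<open>q\<close>, and hence \<open>U \<lesssim> p\<close> in any case.
\<close>

lemma is_set_Ord_lepoll: "is_set {\<alpha> :: 'v. Ord \<alpha> \<and> elts \<alpha> \<lesssim> elts x}" for x :: "'v::zfc_universe"
proof -
  define q where "q = mk (elts omega \<union> elts x)"
  define p where "p = mk {y. elts y \<subseteq> elts q}"
  define U where "U = {\<alpha> :: 'v. Ord \<alpha> \<and> elts \<alpha> \<lesssim> elts q}"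
  have q: "elts q = elts omega \<union> elts x"
    unfolding q_def by (rule elts_mk[OF is_set_Un[OF is_set_elts is_set_elts]])
  have inf: "infinite (elts q)"
    using infinite_omega by (simp only: q finite_Un) blast
  have qp: "elts q \<prec> elts p"
    unfolding p_def by (rule lesspoll_trans2[OF lesspoll_Pow_self Pow_elts_lepoll])
  then have qp': "elts q \<lesssim> elts p"
    by (rule lesspoll_imp_lepoll)
  with inf have inf': "infinite (elts p)"
    unfolding infinite_le_lepoll by (rule lepoll_trans)
  have "U \<lesssim> elts p"
  proof (rule ccontr)
    assume no: "\<not> U \<lesssim> elts p"
    then have "elts p \<lesssim> U"
      using not_lepoll_iff_lesspoll lesspoll_imp_lepoll by blast
    then obtain g where g: "inj_on g (elts p)" "g ` elts p \<subseteq> U"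
      unfolding lepoll_def by blast
    have "\<not> (\<exists>\<beta>\<in>U. g ` elts p \<subseteq> elts \<beta>)"
    proof
      assume "\<exists>\<beta>\<in>U. g ` elts p \<subseteq> elts \<beta>"
      then obtain \<beta> where "g ` elts p \<subseteq> elts \<beta>" "elts \<beta> \<lesssim> elts q"
        unfolding U_def by blast
      then have "elts p \<lesssim> elts \<beta>"
        using g(1) unfolding lepoll_def by blast
      also note \<open>elts \<beta> \<lesssim> elts q\<close>
      finally show False
        using qp not_lepoll_iff_lesspoll by blast
    qed
    then have "U \<subseteq> (\<Union>a\<in>g ` elts p. elts (succ a))"
      using g(2) by (intro Ord_unbounded_cover) (auto simp only: U_def)
    moreover have "(\<Union>a\<in>g ` elts p. elts (succ a)) \<lesssim> elts p"
    proof (rule UN_lepoll_infinite[OF inf' image_lepoll])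
      fix a assume "a \<in> g ` elts p"
      then have "elts a \<lesssim> elts q"
        using g(2) unfolding U_def by blast
      then show "elts (succ a) \<lesssim> elts p"
        using succ_lepoll[OF inf'] qp' lepoll_trans by blast
    qed
    ultimately show False
      using no subset_imp_lepoll lepoll_trans by blast
  qed
  then have "is_set U"
    using is_set_lepoll is_set_elts by blast
  moreover have "{\<alpha> :: 'v. Ord \<alpha> \<and> elts \<alpha> \<lesssim> elts x} \<subseteq> U"
    using lepoll_trans subset_imp_lepoll unfolding U_def q by blast
  ultimately show ?thesis
    by (rule is_set_subset)
qed

lemma elts_card_succ [simp]: "elts (card_succ x) = {\<alpha>. Ord \<alpha> \<and> elts \<alpha> \<lesssim> elts x}"
  by (simp add: card_succ_def is_set_Ord_lepoll)

lemma Ord_card_succ: "Ord (card_succ x)"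
  by (rule OrdI) (auto intro: Ord_in_Ord dest: Ord_transD lepoll_trans[OF subset_imp_lepoll, rotated] 
      simp: subset_iff)

lemma not_card_succ_lepoll: "\<not> elts (card_succ x) \<lesssim> elts x"
proof
  assume "elts (card_succ x) \<lesssim> elts x"
  then have "card_succ x \<in> elts (card_succ x)"
    using Ord_card_succ[of x] by (subst elts_card_succ) (intro CollectI conjI)
  then show False
    using mem_not_refl by blast
qed

text \<open>
  A cofinal subset \<open>A\<close> covers the successor cardinal by \<open>|A|\<close> many sets of size at most \<open>|x|\<close>, so the
  successor cardinal would inject into the larger one of \<open>x\<close> and \<open>A\<close>, which is impossible for both.
\<close>

lemma regular_card_succ:
  assumes inf: "infinite (elts x)"
  shows "regular (card_succ x)"
proof -
  have "Card (card_succ x)"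
    unfolding Card_def not_lepoll_iff_lesspoll[symmetric]
    using Ord_card_succ not_card_succ_lepoll lepoll_trans
    by (metis elts_card_succ mem_Collect_eq)
  moreover have "infinite (elts (card_succ x))"
    using not_card_succ_lepoll inf finite_lepoll_infinite by blast
  moreover have "\<exists>\<beta>\<in>elts (card_succ x). \<forall>\<alpha>\<in>A. \<alpha> \<in> elts \<beta>"
    if A: "A \<subseteq> elts (card_succ x)" "A \<prec> elts (card_succ x)" for A
  proof (rule ccontr)
    assume no: "\<not> ?thesis"
    have cover: "elts (card_succ x) \<subseteq> (\<Union>a\<in>A. elts (succ a))"
      using A(1) no by (intro Ord_unbounded_cover) auto
    have small: "elts (succ a) \<lesssim> elts x" if "a \<in> A" for a
      using that A(1) succ_lepoll[OF inf] by auto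
    show False
    proof (cases "A \<lesssim> elts x")
      case True
      then have "(\<Union>a\<in>A. elts (succ a)) \<lesssim> elts x"
        using small by (intro UN_lepoll_infinite[OF inf])
      then show False
        using cover not_card_succ_lepoll by (meson lepoll_trans subset_imp_lepoll)
    next
      case False
      then have xA: "elts x \<lesssim> A"
        using not_lepoll_iff_lesspoll lesspoll_imp_lepoll by blast
      then have "infinite A"
        using inf by (meson infinite_le_lepoll lepoll_trans)
      then have "(\<Union>a\<in>A. elts (succ a)) \<lesssim> A"
        using small xA lepoll_trans by (intro UN_lepoll_infinite) blast+
      then show False
        using cover A(2) not_lepoll_iff_lesspoll by (meson lepoll_trans subset_imp_lepoll)
    qed
  qed
  ultimately show ?thesis
    unfolding regular_def by blast
qed

lemma regular_Ord: "regular \<kappa> \<Longrightarrow> Ord \<kappa>"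
  by (simp add: regular_def Card_def)

lemma regular_lesspoll: "regular \<kappa> \<Longrightarrow> \<alpha> \<in> elts \<kappa> \<Longrightarrow> elts \<alpha> \<prec> elts \<kappa>"
  by (simp add: regular_def Card_def)

lemma regular_infinite: "regular \<kappa> \<Longrightarrow> infinite (elts \<kappa>)"
  by (simp add: regular_def)

lemma regular_bounded:
  assumes "regular \<kappa>" "A \<subseteq> elts \<kappa>" "A \<prec> elts \<kappa>"
  obtains \<beta> where "\<beta> \<in> elts \<kappa>" "A \<subseteq> elts \<beta>"
proof -
  have "\<forall>A\<subseteq>elts \<kappa>. A \<prec> elts \<kappa> \<longrightarrow> (\<exists>\<beta>\<in>elts \<kappa>. \<forall>\<alpha>\<in>A. \<alpha> \<in> elts \<beta>)"
    using assms(1) by (simp add: regular_def)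
  from this[rule_format, OF assms(2,3)] show thesis
    using that by blast
qed

text \<open>
  Regularity turns smallness into a bound below \<open>\<kappa>\<close>: an injection of \<open>B\<close> into \<open>\<kappa>\<close> has bounded range.
\<close>

lemma lesspoll_regularE:
  assumes "regular \<kappa>" "B \<prec> elts \<kappa>"
  obtains \<beta> where "\<beta> \<in> elts \<kappa>" "B \<lesssim> elts \<beta>"
proof -
  obtain f where f: "inj_on f B" "f ` B \<subseteq> elts \<kappa>"
    using lesspoll_imp_lepoll[OF assms(2)] unfolding lepoll_def by blast
  moreover have "f ` B \<prec> elts \<kappa>"
    using assms(2) image_lepoll lesspoll_trans1 by blast
  ultimately obtain \<beta> where "\<beta> \<in> elts \<kappa>" "f ` B \<subseteq> elts \<beta>"
    using regular_bounded[OF assms(1)] by metis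
  then show thesis
    using f(1) that unfolding lepoll_def by blast
qed

text \<open>
  Two applications of the previous bound, first to every \<open>f a\<close> and then to the set of bounds so
  obtained, give one \<open>\<beta> < \<kappa>\<close> with \<open>f a \<lesssim> \<beta>\<close> for all \<open>a\<close>; the union is then no larger than
  \<open>A \<times> \<beta>\<close>.
\<close>

lemma UN_lesspoll_regular:
  assumes \<kappa>: "regular \<kappa>" and A: "A \<prec> elts \<kappa>" and f: "\<And>a. a \<in> A \<Longrightarrow> f a \<prec> elts \<kappa>"
  shows "(\<Union>a\<in>A. f a) \<prec> elts \<kappa>"
proof -
  obtain g where g: "\<And>a. a \<in> A \<Longrightarrow> g a \<in> elts \<kappa> \<and> f a \<lesssim> elts (g a)"
  proof -
    have "\<forall>a\<in>A. \<exists>\<beta>. \<beta> \<in> elts \<kappa> \<and> f a \<lesssim> elts \<beta>"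
      using lesspoll_regularE[OF \<kappa> f] by blast
    then show thesis
      by (rule bchoice[THEN exE]) (use that in blast)
  qed
  have "g ` A \<prec> elts \<kappa>"
    using A image_lepoll lesspoll_trans1 by blast
  then obtain \<beta> where \<beta>: "\<beta> \<in> elts \<kappa>" "g ` A \<subseteq> elts \<beta>"
    using regular_bounded[OF \<kappa>, of "g ` A"] g by blast
  have "f a \<lesssim> elts \<beta>" if "a \<in> A" for a
    using g[OF that] \<beta> that Ord_transD[OF Ord_in_Ord[OF regular_Ord[OF \<kappa>] \<beta>(1)]]
    by (meson image_subset_iff lepoll_trans subset_imp_lepoll subsetI)
  then obtain h where h: "\<And>a. a \<in> A \<Longrightarrow> f a \<subseteq> h a ` elts \<beta>"
    unfolding lepoll_iff by metis
  \<comment> \<open>\<open>h a\<close> maps \<open>\<beta>\<close> onto a superset of \<open>f a\<close>.\<close>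
  have "(\<Union>a\<in>A. f a) \<subseteq> (\<lambda>(a, b). h a b) ` (A \<times> elts \<beta>)"
    using h by fastforce
  then have "(\<Union>a\<in>A. f a) \<lesssim> A \<times> elts \<beta>"
    by (rule subset_image_lepoll)
  also have "A \<times> elts \<beta> \<prec> elts \<kappa>"
    using Times_lesspoll_infinite[OF regular_infinite[OF \<kappa>] A regular_lesspoll[OF \<kappa> \<beta>(1)]] .
  finally show ?thesis .
qed

subsection \<open>Countable ordinals\<close>

lemma countable_iff_lepoll_omega: "countable A \<longleftrightarrow> A \<lesssim> elts omega"
proof -
  have "elts (omega :: 'b) \<approx> (UNIV :: nat set)"
    using card_elts_omega unfolding eqpoll_def by blast
  then show ?thesis
    by (meson countable_lepoll countableI_type countableE eqpoll_sym lepoll_def lepoll_trans1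
        lepoll_trans2 subset_UNIV)
qed

lemma regular_omega1: "regular omega1"
  unfolding omega1_def by (rule regular_card_succ[OF infinite_omega])

lemma mem_omega1_iff: "\<alpha> \<in> elts omega1 \<longleftrightarrow> Ord \<alpha> \<and> countable (elts \<alpha>)"
  unfolding omega1_def
  by (simp add: countable_iff_lepoll_omega[where ?'b = 'a])

text \<open>
  As \<open>\<prec>\<close> and \<open>\<lesssim>\<close> compare sets over different types, \<open>A\<close> does not determine the universe in
  which \<open>omega1\<close> is formed; hence the type constraints on \<open>omega1\<close> here and below.
\<close>

lemma lesspoll_omega1_iff: "A \<prec> elts (omega1 :: 'v::zfc_universe) \<longleftrightarrow> countable A"
proof
  assume "A \<prec> elts (omega1 :: 'v)"
  then show "countable A"
    using lesspoll_regularE[OF regular_omega1] mem_omega1_iff countable_lepoll by metis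
next
  assume "countable A"
  then have "A \<lesssim> elts (omega :: 'v)"
    by (simp add: countable_iff_lepoll_omega[where ?'b = 'v])
  then show "A \<prec> elts (omega1 :: 'v)"
    unfolding not_lepoll_iff_lesspoll[symmetric] omega1_def
    using not_card_succ_lepoll lepoll_trans by blast
qed

lemma succ_mem_omega1: "\<alpha> \<in> elts omega1 \<Longrightarrow> succ \<alpha> \<in> elts omega1"
  by (simp add: mem_omega1_iff Ord_succ)

lemma omega1_bounded:
  assumes "countable A" "A \<subseteq> elts omega1"
  obtains \<beta> where "\<beta> \<in> elts omega1" "A \<subseteq> elts \<beta>"
  using regular_bounded[OF regular_omega1 assms(2)] assms(1) lesspoll_omega1_iff by metis

section \<open>Sets of hereditary cardinality below a cardinal\<close>

lemma trans_closure_unfold: "trans_closure x = elts x \<union> (\<Union>y\<in>elts x. trans_closure y)"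
proof -
  have "(y, x) \<in> r\<^sup>+ \<longleftrightarrow> (y, x) \<in> r \<or> (\<exists>z. (y, z) \<in> r\<^sup>+ \<and> (z, x) \<in> r)"
    for y x and r :: "('a \<times> 'a) set"
    by (subst trancl_unfold) blast
  from this[of _ x "{(u, v). u \<in> elts v}"] show ?thesis
    unfolding trans_closure_def by auto
qed

lemma H_mono: "elts \<chi> \<subseteq> elts \<chi>' \<Longrightarrow> H \<chi> \<subseteq> H \<chi>'"
  unfolding H_def using lesspoll_trans2 subset_imp_lepoll by blast

lemma H_memI:
  assumes "regular \<chi>" "elts x \<subseteq> H \<chi>" "elts x \<prec> elts \<chi>"
  shows "x \<in> H \<chi>"
proof -
  have "(\<Union>y\<in>elts x. trans_closure y) \<prec> elts \<chi>"
    using assms by (intro UN_lesspoll_regular) (auto simp: H_def)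
  then show ?thesis
    using Un_lesspoll_infinite[OF regular_infinite assms(3)] assms(1) trans_closure_unfold[of x]
    by (simp add: H_def)
qed

text \<open>
  Closure of \<open>H \<chi>\<close> under countable subsets is the form in which \<open>\<chi> > \<omega>\<^sub>1\<close> is used: every object
  built below from countably many elements of \<open>H \<chi>\<close> stays inside.
\<close>

lemma H_countableI:
  assumes "regular \<chi>" "omega1 \<in> elts \<chi>" "elts x \<subseteq> H \<chi>" "countable (elts x)"
  shows "x \<in> H \<chi>"
proof (rule H_memI[OF assms(1,3)])
  have "elts x \<prec> elts (omega1 :: 'a)"
    using assms(4) by (simp add: lesspoll_omega1_iff)
  then show "elts x \<prec> elts \<chi>"
    using regular_lesspoll[OF assms(1,2)] lesspoll_trans by blast
qed

lemma omega1_subset_H: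
  assumes "regular \<chi>" "omega1 \<in> elts \<chi>"
  shows "elts omega1 \<subseteq> H \<chi>"
proof
  fix \<alpha> :: 'a assume "\<alpha> \<in> elts omega1"
  then show "\<alpha> \<in> H \<chi>"
  proof (induction \<alpha> rule: elts_induct)
    case (1 \<alpha>)
    then show ?case
      using Ord_transD[OF regular_Ord[OF regular_omega1] 1(2)]
      by (intro H_countableI[OF assms]) (auto simp: mem_omega1_iff)
  qed
qed

lemma pair_in_H:
  assumes "regular \<chi>" "omega1 \<in> elts \<chi>" "x \<in> H \<chi>" "y \<in> H \<chi>"
  shows "pair x y \<in> H \<chi>"
proof -
  have *: "mk {x, y} \<in> H \<chi>" if "x \<in> H \<chi>" "y \<in> H \<chi>" for x y
    using that by (intro H_countableI[OF assms(1,2)]) auto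
  have "mk {mk {x, x}, mk {x, y}} \<in> H \<chi>"
    by (intro * assms)
  then show ?thesis unfolding pair_def by simp
qed

lemma seq_in_H:
  assumes "regular \<chi>" "omega1 \<in> elts \<chi>" "\<alpha> \<in> elts omega1" "\<And>i. i \<in> elts \<alpha> \<Longrightarrow> Q i \<in> H \<chi>"
  shows "seq Q \<alpha> \<in> H \<chi>"
proof (rule H_countableI[OF assms(1,2)])
  show "countable (elts (seq Q \<alpha>))"
    using assms(3) by (simp add: mem_omega1_iff)
  show "elts (seq Q \<alpha>) \<subseteq> H \<chi>"
    using assms(4) omega1_subset_H[OF assms(1,2)] 
      Ord_transD[OF regular_Ord[OF regular_omega1] assms(3)] by (auto intro!: pair_in_H[OF assms(1,2)])
qed

text \<open>
  Relates the two bounds on \<open>\<theta>\<close>: since \<open>\<mu> < 2\<^bsup>\<mu>\<^esup>\<close>, every \<open>\<theta>\<close> above \<open>2\<^bsup><\<kappa>\<^esup>\<close> is above \<open>\<kappa>\<close>. The class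
  that defines \<open>2\<^bsup><\<kappa>\<^esup>\<close> has to be seen to be a set first.
\<close>

lemma subset_two_pow_below: 
  fixes \<kappa> :: "'v::zfc_universe"
  assumes "Ord \<kappa>"
  shows "elts \<kappa> \<subseteq> elts (two_pow_below \<kappa>)"
proof -
  have "is_set {\<alpha> :: 'v. Ord \<alpha> \<and> (\<exists>\<mu>\<in>elts \<kappa>. elts \<alpha> \<prec> Pow (elts \<mu>))}"
  proof (rule is_set_subset)
    let ?P = "\<lambda>\<mu> :: 'v. mk {y :: 'v. elts y \<subseteq> elts \<mu>}"
    show "is_set (\<Union>\<mu>\<in>elts \<kappa>. elts (card_succ (?P \<mu>)))"
      by (rule is_set_UN) simp
    have "Pow (elts \<mu>) \<lesssim> elts (?P \<mu>)" for \<mu> :: 'v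
      by (rule Pow_elts_lepoll)
    then show "{\<alpha> :: 'v. Ord \<alpha> \<and> (\<exists>\<mu>\<in>elts \<kappa>. elts \<alpha> \<prec> Pow (elts \<mu>))} \<subseteq> (\<Union>\<mu>\<in>elts \<kappa>. elts (card_succ (?P \<mu>)))"
      using lesspoll_imp_lepoll lepoll_trans by auto blast
  qed
  then show ?thesis
    unfolding two_pow_below_def using assms Ord_in_Ord lesspoll_Pow_self by auto
qed

section \<open>Closed unbounded sets\<close>

lemma mem_omega1_subsets_iff:
  "X \<in> omega1_subsets Y \<longleftrightarrow> X \<subseteq> Y \<and> X \<lesssim> elts (omega1 :: 'v) \<and> elts (omega1 :: 'v) \<lesssim> X"
  for X Y :: "'v::zfc_universe set"
  unfolding omega1_subsets_def mem_Collect_eq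
  using eqpoll_imp_lepoll eqpoll_sym lepoll_antisym by metis

lemma countable_lepoll_omega1: "countable A \<Longrightarrow> A \<lesssim> elts omega1"
  using lesspoll_omega1_iff lesspoll_imp_lepoll by blast

lemma omega1_subsets_Un:
  fixes X Y :: "'v::zfc_universe set"
  assumes "X \<in> omega1_subsets Y" "A \<subseteq> Y" "A \<lesssim> elts (omega1 :: 'v)"
  shows "X \<union> A \<in> omega1_subsets Y"
proof -
  have "X \<union> A \<lesssim> elts (omega1 :: 'v)"
    using assms by (intro Un_lepoll_infinite[OF regular_infinite[OF regular_omega1]])
      (simp_all only: mem_omega1_subsets_iff)
  moreover have "elts (omega1 :: 'v) \<lesssim> X \<union> A"
    using assms(1) lepoll_trans[OF _ subset_imp_lepoll[OF Un_upper1]]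
    unfolding mem_omega1_subsets_iff by blast
  ultimately show ?thesis
    using assms(1,2) unfolding mem_omega1_subsets_iff by blast
qed

lemma omega1_subsets_UN:
  fixes D :: "'v::zfc_universe \<Rightarrow> 'v set"
  assumes "elts \<alpha> \<noteq> {}" "elts \<alpha> \<lesssim> elts (omega1 :: 'v)" "\<forall>\<xi>\<in>elts \<alpha>. D \<xi> \<in> omega1_subsets Y"
  shows "(\<Union>\<xi>\<in>elts \<alpha>. D \<xi>) \<in> omega1_subsets Y"
proof -
  have D: "D \<xi> \<subseteq> Y" "D \<xi> \<lesssim> elts (omega1 :: 'v)" "elts (omega1 :: 'v) \<lesssim> D \<xi>" if "\<xi> \<in> elts \<alpha>" for \<xi>
    using assms(3) that unfolding mem_omega1_subsets_iff by blast+
  have "(\<Union>\<xi>\<in>elts \<alpha>. D \<xi>) \<lesssim> elts (omega1 :: 'v)"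
    by (rule UN_lepoll_infinite[OF regular_infinite[OF regular_omega1] assms(2) D(2)])
  moreover obtain \<xi> where "\<xi> \<in> elts \<alpha>"
    using assms(1) by blast
  then have "elts (omega1 :: 'v) \<lesssim> (\<Union>\<xi>\<in>elts \<alpha>. D \<xi>)"
    by (intro lepoll_trans[OF D(3) subset_imp_lepoll]) auto
  ultimately show ?thesis
    using D(1) unfolding mem_omega1_subsets_iff by blast
qed

lemma ctbl_subsets_UN:
  fixes D :: "'v::zfc_universe \<Rightarrow> 'v set"
  assumes "elts \<alpha> \<lesssim> elts (omega :: 'v)" "\<forall>\<xi>\<in>elts \<alpha>. D \<xi> \<in> ctbl_subsets Y"
  shows "(\<Union>\<xi>\<in>elts \<alpha>. D \<xi>) \<in> ctbl_subsets Y"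
proof -
  have "countable (elts \<alpha>)"
    using assms(1) countable_iff_lepoll_omega[where ?'b = 'v] by blast
  then have "countable (\<Union>\<xi>\<in>elts \<alpha>. D \<xi>)"
    using assms(2) by (intro countable_UN) (auto simp: ctbl_subsets_def)
  then show ?thesis
    using assms(2) by (auto simp: ctbl_subsets_def)
qed

lemma club_subset: "club \<nu> P C \<Longrightarrow> x \<in> C \<Longrightarrow> x \<in> P"
  unfolding club_def by blast

lemma club_unbounded: "club \<nu> P C \<Longrightarrow> x \<in> P \<Longrightarrow> \<exists>y\<in>C. x \<subseteq> y"
  unfolding club_def by blast

lemma club_closed:
  fixes \<nu> \<alpha> :: "'v::zfc_universe"
  assumes "club \<nu> P C" "Ord \<alpha>" "elts \<alpha> \<noteq> {}" "elts \<alpha> \<lesssim> elts \<nu>" "\<And>\<xi>. \<xi> \<in> elts \<alpha> \<Longrightarrow> D \<xi> \<in> C"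
    "\<And>\<eta> \<xi>. \<eta> \<in> elts \<alpha> \<Longrightarrow> \<xi> \<in> elts \<eta> \<Longrightarrow> D \<xi> \<subseteq> D \<eta>"
  shows "(\<Union>\<xi>\<in>elts \<alpha>. D \<xi>) \<in> C"
proof -
  have "\<forall>(\<alpha> :: 'v) D. Ord \<alpha> \<and> elts \<alpha> \<noteq> {} \<and> elts \<alpha> \<lesssim> elts \<nu> \<and> (\<forall>\<xi> \<in> elts \<alpha>. D \<xi> \<in> C) \<and>
        (\<forall>\<eta> \<in> elts \<alpha>. \<forall>\<xi> \<in> elts \<eta>. D \<xi> \<subseteq> D \<eta>) \<longrightarrow> (\<Union>\<xi> \<in> elts \<alpha>. D \<xi>) \<in> C"
    using assms(1) unfolding club_def by (elim conjE) assumption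
  from this[rule_format, of \<alpha> D] show ?thesis
    using assms(2-6) by simp
qed

text \<open>
  Clubs are closed under unions indexed by ordinals of the universe; the cardinalities of the elements
  of \<open>omega\<close> translate this into a statement on sequences indexed by natural numbers.
\<close>

lemma club_nat_UN:
  fixes \<nu> :: "'v::zfc_universe" and c :: "nat \<Rightarrow> 'v set"
  assumes C: "club \<nu> P C" and \<nu>: "elts (omega :: 'v) \<lesssim> elts \<nu>"
    and c: "\<And>n. c n \<in> C" "\<And>n. c n \<subseteq> c (Suc n)"
  shows "(\<Union>n. c n) \<in> C"
proof -
  have img: "(\<lambda>\<xi>. card (elts \<xi>)) ` elts (omega :: 'v) = UNIV"
    using card_elts_omega unfolding bij_betw_def by blast
  have mono: "m \<le> n \<Longrightarrow> c m \<subseteq> c n" for m n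
    using c(2) by (rule lift_Suc_mono_le)
  have "(\<Union>\<xi>\<in>elts (omega :: 'v). c (card (elts \<xi>))) \<in> C"
  proof (rule club_closed[where D = "\<lambda>\<xi>. c (card (elts \<xi>))", OF C _ _ \<nu> c(1)])
    show "Ord (omega :: 'v)"
      by (rule OrdI) (auto intro: Ord_in_Ord dest: Ord_transD intro: finite_subset simp: subset_iff)
    show "elts (omega :: 'v) \<noteq> {}"
      using infinite_omega by (metis finite.emptyI)
    fix \<eta> \<xi> :: 'v assume "\<eta> \<in> elts omega" "\<xi> \<in> elts \<eta>"
    then have "elts \<xi> \<subseteq> elts \<eta>" "finite (elts \<eta>)"
      using Ord_transD by auto
    then show "c (card (elts \<xi>)) \<subseteq> c (card (elts \<eta>))"
      by (intro mono card_mono)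
  qed
  also have "(\<Union>\<xi>\<in>elts (omega :: 'v). c (card (elts \<xi>))) = \<Union> (c ` (\<lambda>\<xi>. card (elts \<xi>)) ` elts (omega :: 'v))"
    by (simp only: image_image)
  finally show ?thesis
    by (simp only: img)
qed

text \<open>
  The pull-back of a club along the trace \<open>X \<mapsto> X \<inter> Z\<close>. It is used twice: to go from \<open>H \<theta>\<close> up to \<open>H \<theta>'\<close>
  for subsets of size \<open>\<omega>\<^sub>1\<close>, and from \<open>W \<inter> H \<kappa>'\<close> up to \<open>W \<inter> H \<kappa>\<close> for countable subsets. It is
  unbounded because a set \<open>y \<subseteq> Z\<close> of the club that contains \<open>X \<inter> Z\<close> can be added to \<open>X\<close>,
  after which the trace is exactly \<open>y\<close>.
\<close>

lemma club_lift:
  fixes \<nu> :: "'v::zfc_universe"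
  assumes C: "club \<nu> P C"
    and ex: "\<And>X. X \<in> P' \<Longrightarrow> \<exists>z\<in>P. X \<inter> Z \<subseteq> z"
    and un: "\<And>X y. X \<in> P' \<Longrightarrow> y \<in> P \<Longrightarrow> X \<union> y \<in> P'"
    and sub: "\<And>y. y \<in> P \<Longrightarrow> y \<subseteq> Z"
    and cl: "\<And>\<alpha> D. elts \<alpha> \<noteq> {} \<Longrightarrow> elts (\<alpha> :: 'v) \<lesssim> elts \<nu> \<Longrightarrow> \<forall>\<xi>\<in>elts \<alpha>. D \<xi> \<in> P' \<Longrightarrow>
                (\<Union>\<xi>\<in>elts \<alpha>. D \<xi>) \<in> P'"
  shows "club \<nu> P' {X \<in> P'. X \<inter> Z \<in> C}"
  unfolding club_def
proof (intro conjI ballI allI impI)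
  show "{X \<in> P'. X \<inter> Z \<in> C} \<subseteq> P'"
    by blast
next
  fix X assume X: "X \<in> P'"
  then obtain z where "z \<in> P" "X \<inter> Z \<subseteq> z"
    using ex by blast
  moreover obtain y where y: "y \<in> C" "z \<subseteq> y"
    using club_unbounded[OF C \<open>z \<in> P\<close>] by blast
  ultimately have "(X \<union> y) \<inter> Z = y"
    using sub[OF club_subset[OF C \<open>y \<in> C\<close>]] by blast
  then show "\<exists>y\<in>{X \<in> P'. X \<inter> Z \<in> C}. X \<subseteq> y"
    using un[OF X club_subset[OF C y(1)]] y(1) by (intro bexI[of _ "X \<union> y"]) auto
next
  fix \<alpha> :: 'v and D
  assume a: "Ord \<alpha> \<and> elts \<alpha> \<noteq> {} \<and> elts \<alpha> \<lesssim> elts \<nu> \<and> (\<forall>\<xi>\<in>elts \<alpha>. D \<xi> \<in> {X \<in> P'. X \<inter> Z \<in> C}) \<and>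
       (\<forall>\<eta>\<in>elts \<alpha>. \<forall>\<xi>\<in>elts \<eta>. D \<xi> \<subseteq> D \<eta>)"
  then have "(\<Union>\<xi>\<in>elts \<alpha>. D \<xi> \<inter> Z) \<in> C"
    by (intro club_closed[OF C]) auto
  moreover have "(\<Union>\<xi>\<in>elts \<alpha>. D \<xi>) \<in> P'"
    using a by (intro cl) auto
  ultimately show "(\<Union>\<xi>\<in>elts \<alpha>. D \<xi>) \<in> {X \<in> P'. X \<inter> Z \<in> C}"
    by simp
qed

text \<open>
  This replaces elementary submodels: the required sets are closed under one fixed operation \<open>G\<close>
  instead of being elementary. Unboundedness is the usual interleaving of \<open>\<omega>\<close> many closure steps with
  \<open>\<omega>\<close> many members of the club. The intersection with \<open>Z\<close> allows values of \<open>G\<close> outside \<open>Z\<close>.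
\<close>

lemma club_closed_under:
  fixes G :: "'v::zfc_universe \<Rightarrow> 'v \<Rightarrow> 'v set"
  assumes C: "club omega1 (omega1_subsets Z) C"
    and G: "\<And>x y. countable (G x y)"
  shows "club omega1 (omega1_subsets Z) {X \<in> C. \<forall>x\<in>X. \<forall>y\<in>X. G x y \<inter> Z \<subseteq> X}"
  unfolding club_def
proof (intro conjI ballI allI impI)
  show "{X \<in> C. \<forall>x\<in>X. \<forall>y\<in>X. G x y \<inter> Z \<subseteq> X} \<subseteq> omega1_subsets Z"
    using club_subset[OF C] by blast
next
  fix X assume "X \<in> omega1_subsets Z"
  then obtain c0 where c0: "c0 \<in> C" "X \<subseteq> c0"
    using club_unbounded[OF C] by blast
  have "\<exists>c'\<in>C. c \<union> (\<Union>x\<in>c. \<Union>y\<in>c. G x y \<inter> Z) \<subseteq> c'" if "c \<in> C" for c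
  proof -
    have c: "c \<in> omega1_subsets Z"
      by (rule club_subset[OF C that])
    then have c': "c \<lesssim> elts (omega1 :: 'v)"
      unfolding mem_omega1_subsets_iff by blast
    have inf: "infinite (elts (omega1 :: 'v))"
      by (rule regular_infinite[OF regular_omega1])
    have "(\<Union>x\<in>c. \<Union>y\<in>c. G x y \<inter> Z) \<lesssim> elts (omega1 :: 'v)"
      by (intro UN_lepoll_infinite[OF inf c'] countable_lepoll_omega1 countable_Int1 G)
    then have "c \<union> (\<Union>x\<in>c. \<Union>y\<in>c. G x y \<inter> Z) \<in> omega1_subsets Z"
      by (intro omega1_subsets_Un[OF c]) auto
    then show ?thesis
      by (rule club_unbounded[OF C])
  qed
  then have "\<forall>c\<in>C. \<exists>c'. c' \<in> C \<and> c \<union> (\<Union>x\<in>c. \<Union>y\<in>c. G x y \<inter> Z) \<subseteq> c'"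
    by blast
  then obtain g where g: "\<forall>c\<in>C. g c \<in> C \<and> c \<union> (\<Union>x\<in>c. \<Union>y\<in>c. G x y \<inter> Z) \<subseteq> g c"
    by (rule bchoice[THEN exE])
  define f where "f n = (g ^^ n) c0" for n
  have fC: "f n \<in> C" for n
    by (induction n) (use c0(1) g in \<open>auto simp: f_def\<close>)
  have fS: "f n \<union> (\<Union>x\<in>f n. \<Union>y\<in>f n. G x y \<inter> Z) \<subseteq> f (Suc n)" for n
    using g fC[of n] by (simp add: f_def)
  then have f_le: "f n \<subseteq> f (Suc n)" for n
    unfolding Un_subset_iff by (rule conjunct1)
  have mono: "m \<le> n \<Longrightarrow> f m \<subseteq> f n" for m n
    using f_le by (rule lift_Suc_mono_le)
  have "(\<Union>n. f n) \<in> C"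
    by (intro club_nat_UN[OF C] fC f_le countable_lepoll_omega1)
      (simp add: countable_iff_lepoll_omega[where ?'b = 'v])
  moreover have "G x y \<inter> Z \<subseteq> (\<Union>n. f n)" if "x \<in> f m" "y \<in> f n" for x y m n
  proof -
    have "x \<in> f (max m n)" "y \<in> f (max m n)"
      using that mono[of m "max m n"] mono[of n "max m n"] by auto
    then show ?thesis
      using fS[of "max m n"] by blast
  qed
  moreover have "X \<subseteq> (\<Union>n. f n)"
  proof -
    have "f 0 = c0"
      by (simp add: f_def)
    with c0(2) show ?thesis
      by blast
  qed
  ultimately show "\<exists>y\<in>{X \<in> C. \<forall>x\<in>X. \<forall>y\<in>X. G x y \<inter> Z \<subseteq> X}. X \<subseteq> y"
    by (intro bexI[of _ "\<Union>n. f n"]) blast+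
next
  fix \<alpha> :: 'v and D
  assume a: "Ord \<alpha> \<and> elts \<alpha> \<noteq> {} \<and> elts \<alpha> \<lesssim> elts (omega1 :: 'v) \<and>
       (\<forall>\<xi>\<in>elts \<alpha>. D \<xi> \<in> {X \<in> C. \<forall>x\<in>X. \<forall>y\<in>X. G x y \<inter> Z \<subseteq> X}) \<and>
       (\<forall>\<eta>\<in>elts \<alpha>. \<forall>\<xi>\<in>elts \<eta>. D \<xi> \<subseteq> D \<eta>)"
  then have "(\<Union>\<xi>\<in>elts \<alpha>. D \<xi>) \<in> C"
    by (intro club_closed[OF C]) auto
  moreover have "G x y \<inter> Z \<subseteq> (\<Union>\<xi>\<in>elts \<alpha>. D \<xi>)"
    if x: "\<xi> \<in> elts \<alpha>" "x \<in> D \<xi>" and y: "\<eta> \<in> elts \<alpha>" "y \<in> D \<eta>" for \<xi> \<eta> x y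
  proof -
    have "\<xi> \<in> elts \<eta> \<or> \<xi> = \<eta> \<or> \<eta> \<in> elts \<xi>"
    proof (rule Ord_linear)
      show "Ord \<xi>" "Ord \<eta>"
        using a x(1) y(1) Ord_in_Ord[of \<alpha>] by blast+
    qed
    then obtain \<zeta> where z: "\<zeta> \<in> elts \<alpha>" "x \<in> D \<zeta>" "y \<in> D \<zeta>"
      using a x y by blast
    then have "G x y \<inter> Z \<subseteq> D \<zeta>"
      using a by blast
    then show ?thesis
      using z(1) by blast
  qed
  ultimately show "(\<Union>\<xi>\<in>elts \<alpha>. D \<xi>) \<in> {X \<in> C. \<forall>x\<in>X. \<forall>y\<in>X. G x y \<inter> Z \<subseteq> X}"
    by blast
qed

text \<open>
  Stationarity passes to traces because clubs lift along them.
\<close>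

lemma stationary_ctbl_restrict:
  fixes N Z :: "'v::zfc_universe set"
  assumes "stationary_ctbl N (F \<inter> ctbl_subsets N)"
  shows "stationary_ctbl (N \<inter> Z) ((F \<down> Z) \<inter> ctbl_subsets (N \<inter> Z))"
  unfolding stationary_ctbl_def
proof (intro conjI allI impI)
  show "(F \<down> Z) \<inter> ctbl_subsets (N \<inter> Z) \<subseteq> ctbl_subsets (N \<inter> Z)"
    by blast
  fix C assume C: "club omega (ctbl_subsets (N \<inter> Z)) C"
  have "club omega (ctbl_subsets N) {X \<in> ctbl_subsets N. X \<inter> (N \<inter> Z) \<in> C}"
  proof (rule club_lift[OF C _ _ _ ctbl_subsets_UN])
    fix X assume "X \<in> ctbl_subsets N"
    then show "\<exists>z\<in>ctbl_subsets (N \<inter> Z). X \<inter> (N \<inter> Z) \<subseteq> z"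
      by (intro bexI[of _ "X \<inter> (N \<inter> Z)"]) (auto simp: ctbl_subsets_def)
  qed (auto simp: ctbl_subsets_def)
  then obtain x where x: "x \<in> F" "x \<in> ctbl_subsets N" "x \<inter> (N \<inter> Z) \<in> C"
    using assms unfolding stationary_ctbl_def by blast
  have "x \<inter> (N \<inter> Z) = x \<inter> Z"
    using x(2) unfolding ctbl_subsets_def by blast
  then have "x \<inter> Z \<in> C" "x \<inter> Z \<in> F \<down> Z"
    using x unfolding restrict_family_def by auto
  then show "(F \<down> Z) \<inter> ctbl_subsets (N \<inter> Z) \<inter> C \<noteq> {}"
    using club_subset[OF C] by blast
qed

section \<open>Approaching the union of a chain from inside\<close>

text \<open>
  The chain \<open>M\<close> given by \<open>M \<alpha> = ((\<Union>i<\<alpha>. Q i) \<inter> H k) \<union> {M \<beta> | \<beta> < \<alpha>}\<close>. The second part makes it an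
  \<open>\<in>\<close>-chain by force; this is needed since \<open>Q i \<in> Q (i+1)\<close> gives neither \<open>Q i \<subseteq> Q (i+1)\<close> nor
  \<open>Q i \<in> Q (i+2)\<close>, and since \<open>Q i \<inter> H k\<close> need not belong to any \<open>Q j\<close>.
\<close>

definition approx_chain :: "('v::zfc_universe \<Rightarrow> 'v) \<Rightarrow> 'v \<Rightarrow> 'v \<Rightarrow> 'v" where
  "approx_chain Q k = wfrec {(x, y). x \<in> elts y}
     (\<lambda>M \<alpha>. mk ((\<Union>i\<in>elts \<alpha>. elts (Q i)) \<inter> H k \<union> M ` elts \<alpha>))"

lemma elts_approx_chain:
  "elts (approx_chain Q k \<alpha>) = (\<Union>i\<in>elts \<alpha>. elts (Q i)) \<inter> H k \<union> approx_chain Q k ` elts \<alpha>"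
proof -
  have "approx_chain Q k \<alpha> = mk ((\<Union>i\<in>elts \<alpha>. elts (Q i)) \<inter> H k \<union>
      cut (approx_chain Q k) {(x, y). x \<in> elts y} \<alpha> ` elts \<alpha>)"
    unfolding approx_chain_def by (rule wfrec[OF foundation])
  also have "cut (approx_chain Q k) {(x, y). x \<in> elts y} \<alpha> ` elts \<alpha> = approx_chain Q k ` elts \<alpha>"
    by (intro image_cong) (auto simp: cut_apply)
  finally have "approx_chain Q k \<alpha> = mk ((\<Union>i\<in>elts \<alpha>. elts (Q i)) \<inter> H k \<union> approx_chain Q k ` elts \<alpha>)" .
  moreover have "is_set ((\<Union>i\<in>elts \<alpha>. elts (Q i)) \<inter> H k)"
    by (rule is_set_subset[OF is_set_UN[OF is_set_elts, of Q \<alpha>]]) blast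
  ultimately show ?thesis
    by simp
qed

lemma approx_chain_cong:
  assumes "Ord \<alpha>" "\<And>i. i \<in> elts \<alpha> \<Longrightarrow> Q i = Q' i"
  shows "approx_chain Q k \<alpha> = approx_chain Q' k \<alpha>"
  using assms
proof (induction \<alpha> rule: elts_induct)
  case (1 \<alpha>)
  have "approx_chain Q k ` elts \<alpha> = approx_chain Q' k ` elts \<alpha>"
  proof (intro image_cong refl 1(1))
    fix \<beta> i assume "\<beta> \<in> elts \<alpha>" "i \<in> elts \<beta>"
    then show "Q i = Q' i"
      using 1(2,3) Ord_transD by blast
  qed (auto intro: Ord_in_Ord[OF 1(2)])
  moreover have "(\<Union>i\<in>elts \<alpha>. elts (Q i)) = (\<Union>i\<in>elts \<alpha>. elts (Q' i))"
    using 1(3) by simp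
  ultimately show ?case
    by (intro extensionality) (simp only: elts_approx_chain)
qed

lemma approx_chain_in_H:
  assumes k: "regular k" "omega1 \<in> elts k"
    and Q: "\<And>i. i \<in> elts omega1 \<Longrightarrow> countable (elts (Q i))"
    and "\<alpha> \<in> elts omega1"
  shows "approx_chain Q k \<alpha> \<in> H k"
  using assms(4)
proof (induction \<alpha> rule: elts_induct)
  case (1 \<alpha>)
  have \<alpha>: "\<beta> \<in> elts omega1" if "\<beta> \<in> elts \<alpha>" for \<beta>
    using Ord_transD[OF regular_Ord[OF regular_omega1] 1(2) that] .
  have "countable (elts \<alpha>)"
    using 1(2) by (simp add: mem_omega1_iff)
  then have "countable (elts (approx_chain Q k \<alpha>))"
    unfolding elts_approx_chain
    by (intro countable_Un countable_Int1 countable_UN countable_image Q \<alpha>)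
  moreover have "elts (approx_chain Q k \<alpha>) \<subseteq> H k"
    unfolding elts_approx_chain using 1(1) \<alpha> by blast
  ultimately show ?case
    by (intro H_countableI[OF k])
qed

text \<open>
  For \<open>s = \<langle>Q i | i < \<alpha>\<rangle>\<close>, these are the corresponding member and initial segment of
  \<open>approx_chain Q k\<close>. As a set-valued operation of \<open>s\<close> and \<open>k\<close> alone it is a possible closure
  requirement on \<open>X\<close>, although the chain through which \<open>X\<close> is approached is only known after \<open>X\<close> is.
\<close>

definition approx_codes :: "'v::zfc_universe \<Rightarrow> 'v \<Rightarrow> 'v set" where
  "approx_codes s k = {r. \<exists>Q \<alpha>. \<alpha> \<in> elts omega1 \<and> s = seq Q \<alpha> \<and>
     (r = approx_chain Q k \<alpha> \<or> r = seq (approx_chain Q k) \<alpha>)}"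

text \<open>
  Since \<open>approx_chain Q k \<alpha>\<close> depends only on the entries of \<open>Q\<close> below \<open>\<alpha>\<close>, and these can be read off from
  \<open>seq Q \<alpha>\<close>, there are at most two codes.
\<close>

lemma countable_approx_codes: "countable (approx_codes s k)"
proof (cases "\<exists>Q. \<exists>\<alpha>\<in>elts omega1. s = seq Q \<alpha>")
  case True
  then obtain Q \<alpha> where Q: "\<alpha> \<in> elts omega1" "s = seq Q \<alpha>"
    by blast
  have "approx_codes s k \<subseteq> {approx_chain Q k \<alpha>, seq (approx_chain Q k) \<alpha>}"
  proof
    fix r assume "r \<in> approx_codes s k"
    then obtain Q' \<beta> where r: "s = seq Q' \<beta>" 
      "r = approx_chain Q' k \<beta> \<or> r = seq (approx_chain Q' k) \<beta>"
      unfolding approx_codes_def by blast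
    then have eq: "\<beta> = \<alpha>" "\<And>i. i \<in> elts \<alpha> \<Longrightarrow> Q' i = Q i"
      using seq_eqD[of Q' \<beta> Q \<alpha>] Q(2) by auto
    have \<alpha>: "Ord \<alpha>"
      using Q(1) by (simp add: mem_omega1_iff)
    have "approx_chain Q' k \<gamma> = approx_chain Q k \<gamma>" if "\<gamma> = \<alpha> \<or> \<gamma> \<in> elts \<alpha>" for \<gamma>
      using that eq(2) \<alpha> Ord_in_Ord Ord_transD by (intro approx_chain_cong) blast+
    moreover from this have "seq (approx_chain Q' k) \<alpha> = seq (approx_chain Q k) \<alpha>"
      by (intro extensionality) simp
    ultimately show "r \<in> {approx_chain Q k \<alpha>, seq (approx_chain Q k) \<alpha>}"
      using r(2) eq(1) by auto
  qed
  then show ?thesis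
    by (rule countable_subset) simp
next
  case False
  then have "approx_codes s k = {}"
    unfolding approx_codes_def by blast
  then show ?thesis
    by simp
qed

text \<open>
  The sets added to the chain are themselves members of \<open>W \<inter> H k\<close>, so the union of \<open>approx_chain Q k\<close>
  is still \<open>(\<Union>i. Q i) \<inter> H k\<close>; the initial segments lie in \<open>H k\<close> because they are countable.
\<close>

lemma internally_approachable_approx_chain:
  assumes k: "regular k" "omega1 \<in> elts k"
    and Q: "\<And>i. i \<in> elts omega1 \<Longrightarrow> countable (elts (Q i))"
    and W: "W \<inter> H k = (\<Union>i\<in>elts omega1. elts (Q i)) \<inter> H k"
    and M: "\<And>\<alpha>. \<alpha> \<in> elts omega1 \<Longrightarrow> approx_chain Q k \<alpha> \<in> W"
           "\<And>\<alpha>. \<alpha> \<in> elts omega1 \<Longrightarrow> seq (approx_chain Q k) \<alpha> \<in> W"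
  shows "internally_approachable (W \<inter> H k)"
  unfolding internally_approachable_def
proof (intro exI[of _ "approx_chain Q k"] conjI ballI)
  have tr: "\<beta> \<in> elts omega1" if "\<alpha> \<in> elts omega1" "\<beta> \<in> elts \<alpha>" for \<alpha> \<beta> :: 'a
    using Ord_transD[OF regular_Ord[OF regular_omega1] that] .
  have H: "approx_chain Q k \<alpha> \<in> H k" if "\<alpha> \<in> elts omega1" for \<alpha>
    by (rule approx_chain_in_H[OF k _ that]) (rule Q)
  show "approx_chain Q k \<alpha> \<in> elts (approx_chain Q k \<beta>)" if "\<alpha> \<in> elts \<beta>" for \<alpha> \<beta>
    unfolding elts_approx_chain using that by blast
  show "seq (approx_chain Q k) \<alpha> \<in> W \<inter> H k" if "\<alpha> \<in> elts omega1" for \<alpha>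
  proof
    show "seq (approx_chain Q k) \<alpha> \<in> W"
      by (rule M(2)[OF that])
    show "seq (approx_chain Q k) \<alpha> \<in> H k"
      by (rule seq_in_H[OF k that H[OF tr[OF that]]])
  qed
  show "W \<inter> H k = (\<Union>\<alpha>\<in>elts omega1. elts (approx_chain Q k \<alpha>))"
  proof (intro equalityI subsetI)
    fix x assume x: "x \<in> W \<inter> H k"
    then obtain i where "i \<in> elts omega1" "x \<in> elts (Q i)"
      using W by blast
    then have "x \<in> elts (approx_chain Q k (succ i))"
      using x unfolding elts_approx_chain by simp
    then show "x \<in> (\<Union>\<alpha>\<in>elts omega1. elts (approx_chain Q k \<alpha>))"
      using succ_mem_omega1[OF \<open>i \<in> elts omega1\<close>] by blast
  next
    fix x assume "x \<in> (\<Union>\<alpha>\<in>elts omega1. elts (approx_chain Q k \<alpha>))"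
    then obtain \<alpha> where \<alpha>: "\<alpha> \<in> elts omega1" "x \<in> elts (approx_chain Q k \<alpha>)"
      by blast
    from this(2) show "x \<in> W \<inter> H k"
      unfolding elts_approx_chain
      using W M(1) H tr[OF \<alpha>(1)] by blast
  qed
qed

section \<open>Stationary reflection along a chain\<close>

lemma exists_mem_minimal:
  fixes A :: "'v::zfc_universe set"
  assumes "a \<in> A"
  shows "\<exists>m\<in>A. \<forall>b\<in>A. b \<notin> elts m"
  using wfE_min[OF foundation assms] by (metis (no_types, lifting) case_prodI mem_Collect_eq)

text \<open>
  At limits \<open>l\<close> the chain is continuous, and so it is increasing along limits even though \<open>Q i \<subseteq> Q (i+1)\<close>
  may fail; this gives closure. For unboundedness, sets \<open>c\<^sub>n \<in> C\<close> and the sets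
  \<open>R l = (\<Union>i<l. Q i)\<close> are interleaved, \<open>R l\<^sub>0 \<subseteq> c\<^sub>0 \<subseteq> R l\<^sub>1 \<subseteq> c\<^sub>1 \<subseteq> \<dots>\<close>, and the supremum of the
  \<open>l\<^sub>n\<close> is a limit at which the chain takes the value \<open>\<Union>\<^sub>n c\<^sub>n\<close>.
\<close>

lemma club_ord_chain:
  fixes Q :: "'v::zfc_universe \<Rightarrow> 'v"
  assumes ctbl: "\<And>i. i \<in> elts omega1 \<Longrightarrow> countable (elts (Q i))"
    and cont: "\<And>l. l \<in> elts omega1 \<Longrightarrow> Limit l \<Longrightarrow> elts (Q l) = (\<Union>i\<in>elts l. elts (Q i))"
    and N: "N = (\<Union>i\<in>elts omega1. elts (Q i))"
    and C: "club omega (ctbl_subsets N) C"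
  shows "club_ord omega1 {l \<in> elts omega1. Limit l \<and> elts (Q l) \<in> C}"
  unfolding club_ord_def
proof (intro conjI ballI impI)
  have tr: "\<beta> \<in> elts omega1" if "\<alpha> \<in> elts omega1" "\<beta> \<in> elts \<alpha>" for \<alpha> \<beta> :: 'v
    using Ord_transD[OF regular_Ord[OF regular_omega1] that] .
  define L where "L = {l \<in> elts omega1. Limit l \<and> elts (Q l) \<in> C}"
  show "{l \<in> elts omega1. Limit l \<and> elts (Q l) \<in> C} \<subseteq> elts omega1"
    by blast
  show "\<delta> \<in> {l \<in> elts omega1. Limit l \<and> elts (Q l) \<in> C}"
    if \<delta>: "\<delta> \<in> elts omega1"
      and lim: "Limit \<delta> \<and> (\<forall>\<alpha>\<in>elts \<delta>. \<exists>\<beta>\<in>{l \<in> elts omega1. Limit l \<and> elts (Q l) \<in> C} \<inter> elts \<delta>. \<alpha> \<in> elts \<beta>)"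
    for \<delta>
  proof -
    \<comment> \<open>Least elements above \<open>\<alpha>\<close>, so that \<open>\<alpha> \<mapsto> b \<alpha>\<close> is monotone and \<open>Q (b \<alpha>)\<close> increases with \<open>\<alpha>\<close>.\<close>
    have "\<forall>\<alpha>\<in>elts \<delta>. \<exists>m. m \<in> {\<beta> \<in> L \<inter> elts \<delta>. \<alpha> \<in> elts \<beta>} \<and> (\<forall>\<beta>\<in>{\<beta> \<in> L \<inter> elts \<delta>. \<alpha> \<in> elts \<beta>}. \<beta> \<notin> elts m)"
    proof
      fix \<alpha> assume "\<alpha> \<in> elts \<delta>"
      then obtain \<beta> where "\<beta> \<in> {\<beta> \<in> L \<inter> elts \<delta>. \<alpha> \<in> elts \<beta>}"
        using lim unfolding L_def by blast
      from exists_mem_minimal[OF this]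
      show "\<exists>m. m \<in> {\<beta> \<in> L \<inter> elts \<delta>. \<alpha> \<in> elts \<beta>} \<and> (\<forall>\<beta>\<in>{\<beta> \<in> L \<inter> elts \<delta>. \<alpha> \<in> elts \<beta>}. \<beta> \<notin> elts m)"
        by blast
    qed
    then obtain b where b': "\<forall>\<alpha>\<in>elts \<delta>. b \<alpha> \<in> {\<beta> \<in> L \<inter> elts \<delta>. \<alpha> \<in> elts \<beta>} \<and> (\<forall>\<beta>\<in>{\<beta> \<in> L \<inter> elts \<delta>. \<alpha> \<in> elts \<beta>}. \<beta> \<notin> elts (b \<alpha>))"
      by (rule bchoice[THEN exE])
    have b: "b \<alpha> \<in> L" "b \<alpha> \<in> elts \<delta>" "\<alpha> \<in> elts (b \<alpha>)" if "\<alpha> \<in> elts \<delta>" for \<alpha>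
      using b' that by blast+
    have least: "\<beta> \<notin> elts (b \<alpha>)" if "\<alpha> \<in> elts \<delta>" "\<beta> \<in> L" "\<beta> \<in> elts \<delta>" "\<alpha> \<in> elts \<beta>" for \<alpha> \<beta>
      using b' that by blast
    have Ord: "Ord \<delta>"
      using \<delta> by (simp add: mem_omega1_iff)
    have Lim: "elts (Q (b \<alpha>)) = (\<Union>i\<in>elts (b \<alpha>). elts (Q i))" if "\<alpha> \<in> elts \<delta>" for \<alpha>
      using cont b(1)[OF that] unfolding L_def by blast
    have "(\<Union>\<alpha>\<in>elts \<delta>. elts (Q (b \<alpha>))) \<in> C"
    proof (rule club_closed[OF C Ord])
      show "elts \<delta> \<noteq> {}"
        using lim unfolding Limit_def by blast
      show "elts \<delta> \<lesssim> elts (omega :: 'v)"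
        using \<delta> mem_omega1_iff countable_iff_lepoll_omega by blast
      show "elts (Q (b \<alpha>)) \<in> C" if "\<alpha> \<in> elts \<delta>" for \<alpha>
        using b(1)[OF that] unfolding L_def by blast
      fix \<eta> \<xi> assume \<eta>: "\<eta> \<in> elts \<delta>" "\<xi> \<in> elts \<eta>"
      have \<xi>: "\<xi> \<in> elts \<delta>"
        using Ord_transD[OF Ord \<eta>] .
      have o: "Ord (b \<eta>)" "Ord (b \<xi>)"
        using b(2) \<eta>(1) \<xi> Ord_in_Ord[OF Ord] by blast+
      have "\<xi> \<in> elts (b \<eta>)"
        using Ord_transD[OF o(1) b(3)[OF \<eta>(1)] \<eta>(2)] .
      then have "b \<eta> \<notin> elts (b \<xi>)"
        using least[OF \<xi> b(1,2)[OF \<eta>(1)]] by blast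
      then have "b \<xi> \<in> elts (b \<eta>) \<or> b \<xi> = b \<eta>"
        using Ord_linear o by blast
      then show "elts (Q (b \<xi>)) \<subseteq> elts (Q (b \<eta>))"
        using Lim[OF \<eta>(1)] by auto
    qed
    also have "(\<Union>\<alpha>\<in>elts \<delta>. elts (Q (b \<alpha>))) = (\<Union>i\<in>elts \<delta>. elts (Q i))"
      using b(2,3) Lim by blast
    also have "\<dots> = elts (Q \<delta>)"
      using cont[OF \<delta>] lim by blast
    finally show ?thesis
      using \<delta> lim by blast
  qed
  show "\<exists>\<beta>\<in>{l \<in> elts omega1. Limit l \<and> elts (Q l) \<in> C}. \<alpha> \<in> elts \<beta>" if \<alpha>: "\<alpha> \<in> elts omega1" for \<alpha>
  proof -
    define R where "R l = (\<Union>i\<in>elts l. elts (Q i))" for l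
    have R: "R l \<in> ctbl_subsets N" if "l \<in> elts omega1" for l
      using that tr[OF that] ctbl unfolding R_def N ctbl_subsets_def
      by (auto simp: mem_omega1_iff[of l] intro!: countable_UN)
    have step: "\<exists>p. snd p \<in> elts omega1 \<and> l \<in> elts (snd p) \<and> fst p \<in> C \<and> R l \<subseteq> fst p \<and> fst p \<subseteq> R (snd p)"
      if l: "l \<in> elts omega1" for l
    proof -
      obtain c where c: "c \<in> C" "R l \<subseteq> c"
        using club_unbounded[OF C R[OF l]] by blast
      have "countable c" "c \<subseteq> N"
        using club_subset[OF C c(1)] unfolding ctbl_subsets_def by blast+
      then have "\<forall>x\<in>c. \<exists>i. i \<in> elts omega1 \<and> x \<in> elts (Q i)"
        unfolding N by blast
      then obtain g where g: "\<forall>x\<in>c. g x \<in> elts omega1 \<and> x \<in> elts (Q (g x))"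
        by (rule bchoice[THEN exE])
      have "countable (insert l (g ` c))" "insert l (g ` c) \<subseteq> elts omega1"
        using \<open>countable c\<close> l g by auto
      then obtain l' where l': "l' \<in> elts omega1" "insert l (g ` c) \<subseteq> elts l'"
        by (rule omega1_bounded)
      have "c \<subseteq> R l'"
        using g l'(2) unfolding R_def by blast
      then show ?thesis
        using c l' by (intro exI[of _ "(c, l')"]) auto
    qed
    then have "\<forall>l\<in>elts omega1. \<exists>p. snd p \<in> elts omega1 \<and> l \<in> elts (snd p) \<and> fst p \<in> C \<and> R l \<subseteq> fst p \<and> fst p \<subseteq> R (snd p)"
      by blast
    then obtain p where p: "\<forall>l\<in>elts omega1. snd (p l) \<in> elts omega1 \<and> l \<in> elts (snd (p l)) \<and> fst (p l) \<in> C \<and> R l \<subseteq> fst (p l) \<and> fst (p l) \<subseteq> R (snd (p l))"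
      by (rule bchoice[THEN exE])
    define l where "l n = ((snd \<circ> p) ^^ n) \<alpha>" for n
    define c where "c n = fst (p (l n))" for n
    have l: "l n \<in> elts omega1" for n
      by (induction n) (use \<alpha> p in \<open>auto simp: l_def\<close>)
    have lS: "l (Suc n) = snd (p (l n))" for n
      by (simp add: l_def)
    have pl: "l n \<in> elts (l (Suc n))" "c n \<in> C" "R (l n) \<subseteq> c n" "c n \<subseteq> R (l (Suc n))" for n
      using p l[of n] unfolding lS c_def by blast+
    define \<mu> where "\<mu> = mk (\<Union>n. elts (l n))"
    have "countable (range l)" "range l \<subseteq> elts omega1"
      using l by auto
    then obtain \<beta> where \<beta>: "\<beta> \<in> elts omega1" "range l \<subseteq> elts \<beta>"
      by (rule omega1_bounded)
    have "Ord \<beta>"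
      using \<beta>(1) by (simp add: mem_omega1_iff)
    have "is_set (\<Union>n. elts (l n))"
      by (rule is_set_subset[OF is_set_elts[of \<beta>]]) (use \<beta>(2) Ord_transD[OF \<open>Ord \<beta>\<close>] in blast)
    then have \<mu>: "elts \<mu> = (\<Union>n. elts (l n))"
      unfolding \<mu>_def by (rule elts_mk)
    have Ordl: "Ord (l n)" "countable (elts (l n))" for n
      using l[of n] by (simp_all add: mem_omega1_iff)
    have "Ord \<mu>"
    proof (rule OrdI)
      fix \<gamma> assume "\<gamma> \<in> elts \<mu>"
      then obtain n where n: "\<gamma> \<in> elts (l n)"
        unfolding \<mu> by blast
      show "Ord \<gamma>"
        by (rule Ord_in_Ord[OF Ordl(1) n])
      show "\<xi> \<in> elts \<mu>" if "\<xi> \<in> elts \<gamma>" for \<xi>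
        using Ord_transD[OF Ordl(1) n that] unfolding \<mu> by blast
    qed
    moreover have "countable (elts \<mu>)"
      unfolding \<mu> using Ordl(2) by (intro countable_UN) auto
    ultimately have \<mu>1: "\<mu> \<in> elts omega1"
      by (simp add: mem_omega1_iff)
    have "\<alpha> \<in> elts (l (Suc 0))"
      using pl(1)[of 0] by (simp add: l_def)
    then have "\<alpha> \<in> elts \<mu>"
      unfolding \<mu> by blast
    have "succ \<gamma> \<in> elts \<mu>" if \<gamma>: "\<gamma> \<in> elts \<mu>" for \<gamma>
    proof -
      obtain n where n: "\<gamma> \<in> elts (l n)"
        using \<gamma> unfolding \<mu> by blast
      then have "elts (succ \<gamma>) \<subseteq> elts (l n)" "Ord (succ \<gamma>)"
        using Ord_transD[OF Ordl(1) n] Ord_succ[OF Ord_in_Ord[OF Ordl(1) n]] by auto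
      then have "succ \<gamma> \<in> elts (l n) \<or> succ \<gamma> = l n"
        using Ord_subset_iff[OF _ Ordl(1)] by blast
      then show ?thesis
        using pl(1)[of n] unfolding \<mu> by auto
    qed
    then have lim: "Limit \<mu>"
      unfolding Limit_def using \<open>Ord \<mu>\<close> \<open>\<alpha> \<in> elts \<mu>\<close> by blast
    have "elts (Q \<mu>) = (\<Union>n. R (l n))"
      unfolding cont[OF \<mu>1 lim] \<mu> R_def by blast
    also have "\<dots> = (\<Union>n. c n)"
      using pl(3,4) by blast
    also have "\<dots> \<in> C"
    proof (rule club_nat_UN[OF C lepoll_refl pl(2)])
      show "c n \<subseteq> c (Suc n)" for n
        using pl(4)[of n] pl(3)[of "Suc n"] by blast
    qed
    finally have "\<mu> \<in> {l \<in> elts omega1. Limit l \<and> elts (Q l) \<in> C}"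
      using \<mu>1 lim by blast
    with \<open>\<alpha> \<in> elts \<mu>\<close> show ?thesis
      by blast
  qed
qed

text \<open>
  The chain meets a club of countable sets on a club of indices and meets \<open>S\<close> on a stationary set of
  indices, hence it meets both at once.
\<close>

lemma stationary_ctbl_chain:
  assumes Q: "diagonal_chain \<kappa> \<S> X Q" and S: "S \<in> X" "S \<in> \<S>"
  shows "stationary_ctbl (X \<inter> H \<kappa>) (family S \<inter> ctbl_subsets (X \<inter> H \<kappa>))"
  unfolding stationary_ctbl_def
proof (intro conjI allI impI)
  show "family S \<inter> ctbl_subsets (X \<inter> H \<kappa>) \<subseteq> ctbl_subsets (X \<inter> H \<kappa>)"
    by blast
  fix C assume C: "club omega (ctbl_subsets (X \<inter> H \<kappa>)) C"
  have ctbl: "countable (elts (Q i))" if "i \<in> elts omega1" for i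
    using Q that unfolding diagonal_chain_def ctbl_subsets_def by blast
  have cont: "elts (Q l) = (\<Union>i\<in>elts l. elts (Q i))" if "l \<in> elts omega1" "Limit l" for l
    using Q that unfolding diagonal_chain_def by blast
  have N: "X \<inter> H \<kappa> = (\<Union>i\<in>elts omega1. elts (Q i))"
    using Q unfolding diagonal_chain_def by blast
  have "stationary_ord omega1 {i \<in> elts omega1. Q i \<in> elts S}"
    using Q S unfolding diagonal_chain_def by blast
  moreover have "club_ord omega1 {l \<in> elts omega1. Limit l \<and> elts (Q l) \<in> C}"
    by (rule club_ord_chain[OF ctbl cont N C])
  ultimately obtain i where "Q i \<in> elts S" "elts (Q i) \<in> C"
    unfolding stationary_ord_def by blast
  then show "family S \<inter> ctbl_subsets (X \<inter> H \<kappa>) \<inter> C \<noteq> {}"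
    using club_subset[OF C] unfolding family_def by blast
qed

section \<open>The reflection principles\<close>

lemma large_enough_subset:
  assumes "Ord \<kappa>" "large_enough \<kappa> \<S> \<theta>"
  shows "elts \<kappa> \<subseteq> elts \<theta>"
proof -
  have "Ord \<theta>" "two_pow_below \<kappa> \<in> elts \<theta>"
    using assms(2) by (auto simp: large_enough_def Card_def)
  then show ?thesis
    using subset_two_pow_below[OF assms(1)] Ord_transD by blast
qed

lemma large_enough_mono:
  assumes "large_enough \<kappa> \<S> \<theta>" "Card \<theta>'" "elts \<theta> \<subseteq> elts \<theta>'"
  shows "large_enough \<kappa> \<S> \<theta>'"
  using assms H_mono[OF assms(3)] unfolding large_enough_def by blast

text \<open>
  Both reflection principles follow from this one. The case \<open>k = \<kappa>\<close> is kept separate from \<open>k \<in> W\<close> because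
  the sets \<open>W\<close> are not required to contain \<open>\<kappa>\<close>. As \<open>\<theta>\<close> may be singular while diagonal chains are only
  provided over regular cardinals, the proof works at \<open>\<theta>' = \<theta>\<^sup>+\<close> and takes \<open>W\<close> to be the trace
  of \<open>X\<close> on \<open>H \<theta>\<close>; the traces of \<open>W\<close> and \<open>X\<close> on \<open>H k\<close> agree because \<open>k \<le> \<kappa> \<le> \<theta>\<close>.
\<close>

lemma reflection_stationary:
  fixes \<kappa> \<theta> :: "'v::zfc_universe"
  assumes \<kappa>: "regular \<kappa>" "omega1 \<in> elts \<kappa>" and dsrp: "DSRP \<kappa> \<S>" and \<theta>: "large_enough \<kappa> \<S> \<theta>"
  shows "stationary_omega1 (H \<theta>)
     {W \<in> omega1_subsets (H \<theta>). \<forall>k. regular k \<and> omega1 \<in> elts k \<and> elts k \<subseteq> elts \<kappa> \<and> (k = \<kappa> \<or> k \<in> W) \<longrightarrow>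
        internally_approachable (W \<inter> H k) \<and>
        (\<forall>S\<in>W \<inter> \<S>. stationary_ctbl (W \<inter> H k) ((family S \<down> H k) \<inter> ctbl_subsets (W \<inter> H k)))}"
    (is "stationary_omega1 _ ?R")
  unfolding stationary_omega1_def
proof (intro conjI allI impI)
  show "?R \<subseteq> omega1_subsets (H \<theta>)"
    by blast
  fix C assume C: "club omega1 (omega1_subsets (H \<theta>)) C"
  define \<theta>' where "\<theta>' = card_succ \<theta>"
  have \<kappa>\<theta>: "elts \<kappa> \<subseteq> elts \<theta>"
    by (rule large_enough_subset[OF regular_Ord[OF \<kappa>(1)] \<theta>])
  have Ord\<theta>: "Ord \<theta>"
    using \<theta> by (simp add: large_enough_def Card_def)
  have reg: "regular \<theta>'"
    unfolding \<theta>'_def by (rule regular_card_succ) (use regular_infinite[OF \<kappa>(1)] \<kappa>\<theta> finite_subset in blast)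
  have \<theta>\<theta>': "elts \<theta> \<subseteq> elts \<theta>'"
    unfolding \<theta>'_def using Ord\<theta> Ord_in_Ord Ord_transD by (auto intro!: subset_imp_lepoll)
  have H: "H \<kappa> \<subseteq> H \<theta>" "H \<theta> \<subseteq> H \<theta>'"
    by (intro H_mono \<kappa>\<theta> \<theta>\<theta>')+
  have \<omega>1: "elts omega1 \<subseteq> H \<theta>"
    using omega1_subset_H[OF \<kappa>] H(1) by blast
  have large: "large_enough \<kappa> \<S> \<theta>'"
    using large_enough_mono[OF \<theta> _ \<theta>\<theta>'] reg unfolding regular_def by blast

  \<comment> \<open>The trace of \<open>X\<close> may be countable; adding \<open>\<omega>\<^sub>1\<close> brings it back to size \<open>\<omega>\<^sub>1\<close>.\<close>
  have cut: "X \<inter> H \<theta> \<union> elts omega1 \<in> omega1_subsets (H \<theta>)" if "X \<in> omega1_subsets (H \<theta>')" for X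
  proof -
    have "elts omega1 \<in> omega1_subsets (H \<theta>)"
      using \<omega>1 by (simp add: omega1_subsets_def)
    moreover have "X \<inter> H \<theta> \<lesssim> elts (omega1 :: 'v)"
      using that lepoll_trans[OF subset_imp_lepoll[OF Int_lower1]] unfolding mem_omega1_subsets_iff by blast
    ultimately show ?thesis
      using omega1_subsets_Un[of "elts omega1" "H \<theta>" "X \<inter> H \<theta>"] by (simp add: Un_commute)
  qed
  have lifted: "club omega1 (omega1_subsets (H \<theta>')) {X \<in> omega1_subsets (H \<theta>'). X \<inter> H \<theta> \<in> C}"
  proof (rule club_lift[OF C _ _ _ omega1_subsets_UN])
    show "\<exists>z\<in>omega1_subsets (H \<theta>). X \<inter> H \<theta> \<subseteq> z" if "X \<in> omega1_subsets (H \<theta>')" for X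
      using cut[OF that] by blast
    show "X \<union> y \<in> omega1_subsets (H \<theta>')" if "X \<in> omega1_subsets (H \<theta>')" "y \<in> omega1_subsets (H \<theta>)" for X y
      using that H(2) by (intro omega1_subsets_Un) (auto simp: mem_omega1_subsets_iff)
    show "y \<subseteq> H \<theta>" if "y \<in> omega1_subsets (H \<theta>)" for y
      using that by (simp add: omega1_subsets_def)
  qed
  \<comment> \<open>The second set of codes serves the case \<open>k = \<kappa>\<close>, in which \<open>k\<close> need not be in \<open>X\<close>.\<close>
  define E where "E = {X \<in> {X \<in> omega1_subsets (H \<theta>'). X \<inter> H \<theta> \<in> C}.
        \<forall>s\<in>X. \<forall>k\<in>X. (approx_codes s k \<union> approx_codes s \<kappa>) \<inter> H \<theta>' \<subseteq> X}"
  have "club omega1 (omega1_subsets (H \<theta>')) E"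
    unfolding E_def by (intro club_closed_under lifted countable_Un countable_approx_codes)
  moreover have "stationary_omega1 (H \<theta>')
       {X \<in> omega1_subsets (H \<theta>'). elts omega1 \<subseteq> X \<and> (\<exists>Q. diagonal_chain \<kappa> \<S> X Q)}"
    using dsrp reg large unfolding DSRP_def by blast
  ultimately have "{X \<in> omega1_subsets (H \<theta>'). elts omega1 \<subseteq> X \<and> (\<exists>Q. diagonal_chain \<kappa> \<S> X Q)} \<inter> E \<noteq> {}"
    unfolding stationary_omega1_def by (elim conjE allE impE)
  then obtain X Q where X: "X \<in> omega1_subsets (H \<theta>')" "elts omega1 \<subseteq> X" "X \<inter> H \<theta> \<in> C"
    and cl: "\<And>s k. s \<in> X \<Longrightarrow> k \<in> X \<Longrightarrow> (approx_codes s k \<union> approx_codes s \<kappa>) \<inter> H \<theta>' \<subseteq> X"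
    and Q: "diagonal_chain \<kappa> \<S> X Q"
    unfolding E_def by blast
  have ctbl: "countable (elts (Q i))" if "i \<in> elts omega1" for i
    using Q that unfolding diagonal_chain_def ctbl_subsets_def by blast
  have N: "X \<inter> H \<kappa> = (\<Union>i\<in>elts omega1. elts (Q i))"
    using Q unfolding diagonal_chain_def by blast
  have sQ: "seq Q \<alpha> \<in> X" if "\<alpha> \<in> elts omega1" for \<alpha>
    using Q that unfolding diagonal_chain_def by blast

  have "internally_approachable (X \<inter> H \<theta> \<inter> H k) \<and>
      (\<forall>S\<in>X \<inter> H \<theta> \<inter> \<S>. stationary_ctbl (X \<inter> H \<theta> \<inter> H k)
         ((family S \<down> H k) \<inter> ctbl_subsets (X \<inter> H \<theta> \<inter> H k)))"
    if k: "regular k" "omega1 \<in> elts k" "elts k \<subseteq> elts \<kappa>" and kX: "k = \<kappa> \<or> k \<in> X \<inter> H \<theta>" for k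
  proof -
    have Hk: "H k \<subseteq> H \<kappa>"
      by (rule H_mono[OF k(3)])
    have eq: "X \<inter> H \<theta> \<inter> H k = X \<inter> H k" "X \<inter> H \<kappa> \<inter> H k = X \<inter> H k"
      using Hk H(1) by blast+
    have codes: "approx_codes (seq Q \<alpha>) k \<inter> H k \<subseteq> X" if "\<alpha> \<in> elts omega1" for \<alpha>
    proof -
      have "approx_codes (seq Q \<alpha>) k \<inter> H \<theta>' \<subseteq> X"
        \<comment> \<open>For \<open>k = \<kappa>\<close> any element of \<open>X\<close> can be the second argument; \<open>seq Q \<alpha>\<close> is at hand.\<close>
        using cl[OF sQ[OF that] sQ[OF that]] cl[OF sQ[OF that], of k] kX by blast
      then show ?thesis
        using Hk H by blast
    qed
    have tr: "\<beta> \<in> elts omega1" if "\<alpha> \<in> elts omega1" "\<beta> \<in> elts \<alpha>" for \<alpha> \<beta> :: 'v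
      using Ord_transD[OF regular_Ord[OF regular_omega1] that] .
    have M: "approx_chain Q k \<alpha> \<in> H k" if "\<alpha> \<in> elts omega1" for \<alpha>
      by (rule approx_chain_in_H[OF k(1,2) ctbl that])
    have sM: "seq (approx_chain Q k) \<alpha> \<in> H k" if "\<alpha> \<in> elts omega1" for \<alpha>
      by (rule seq_in_H[OF k(1,2) that M[OF tr[OF that]]])
    have "internally_approachable (X \<inter> H k)"
    proof (rule internally_approachable_approx_chain[OF k(1,2) ctbl])
      show "X \<inter> H k = (\<Union>i\<in>elts omega1. elts (Q i)) \<inter> H k"
        using N eq(2) by blast
      show "approx_chain Q k \<alpha> \<in> X" if "\<alpha> \<in> elts omega1" for \<alpha>
        using codes[OF that] M[OF that] that unfolding approx_codes_def by blast
      show "seq (approx_chain Q k) \<alpha> \<in> X" if "\<alpha> \<in> elts omega1" for \<alpha>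
        using codes[OF that] sM[OF that] that unfolding approx_codes_def by blast
    qed
    moreover have "stationary_ctbl (X \<inter> H k) ((family S \<down> H k) \<inter> ctbl_subsets (X \<inter> H k))"
      if "S \<in> X \<inter> \<S>" for S
      using stationary_ctbl_restrict[OF stationary_ctbl_chain[OF Q], of S "H k"] that
      unfolding eq(2) by blast
    ultimately show ?thesis
      unfolding eq(1) by blast
  qed
  moreover have "X \<inter> H \<theta> \<in> omega1_subsets (H \<theta>)"
    using club_subset[OF C X(3)] .
  ultimately show "?R \<inter> C \<noteq> {}"
    using X(3) by blast
qed

lemma stationary_omega1_mono:
  "stationary_omega1 Y R \<Longrightarrow> R \<subseteq> R' \<Longrightarrow> R' \<subseteq> omega1_subsets Y \<Longrightarrow> stationary_omega1 Y R'"
  unfolding stationary_omega1_def by blast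

lemma omega1_in_omega2: "omega1 \<in> elts omega2"
  unfolding omega2_def by (simp add: regular_Ord[OF regular_omega1])

theorem lemma6p6:
  fixes \<kappa> :: "'v::zfc_universe" and \<S> :: "'v set"
  assumes "regular \<kappa>" and "omega1 \<in> elts \<kappa>"
    and "\<And>S. S \<in> \<S> \<Longrightarrow> stationary_ctbl (H \<kappa>) (family S)"
    and "DSRP \<kappa> \<S>"
  shows "wDRP_IA \<kappa> \<S> \<and>
    (\<forall>\<theta>. large_enough \<kappa> \<S> \<theta> \<longrightarrow>
       stationary_omega1 (H \<theta>)
         {W \<in> omega1_subsets (H \<theta>).
            \<forall>S \<in> W \<inter> \<S>. \<forall>\<kappa>'. regular \<kappa>' \<and> \<kappa>' \<in> W \<and> elts omega2 \<subseteq> elts \<kappa>' \<and> elts \<kappa>' \<subseteq> elts \<kappa> \<longrightarrow>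
              internally_approachable (W \<inter> H \<kappa>') \<and>
              stationary_ctbl (W \<inter> H \<kappa>')
                ((family S \<down> H \<kappa>') \<inter> ctbl_subsets (W \<inter> H \<kappa>'))})"
proof (intro conjI allI impI)
  \<comment> \<open>Stationary sets consist of subsets of \<open>H \<kappa>\<close>, so nothing is lost by restricting to it.\<close>
  have whole: "family S \<down> H \<kappa> = family S" if "S \<in> \<S>" for S
  proof -
    have "x \<inter> H \<kappa> = x" if "x \<in> family S" for x
      using assms(3)[OF \<open>S \<in> \<S>\<close>] that unfolding stationary_ctbl_def ctbl_subsets_def by blast
    then show ?thesis
      unfolding restrict_family_def by force
  qed
  show "wDRP_IA \<kappa> \<S>"
    unfolding wDRP_IA_def
  proof (intro allI impI)
    fix \<theta> assume "large_enough \<kappa> \<S> \<theta>"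
    from reflection_stationary[OF assms(1,2,4) this]
    show "stationary_omega1 (H \<theta>) {W \<in> omega1_subsets (H \<theta>). internally_approachable (W \<inter> H \<kappa>) \<and>
       (\<forall>S\<in>W \<inter> \<S>. stationary_ctbl (W \<inter> H \<kappa>) (family S \<inter> ctbl_subsets (W \<inter> H \<kappa>)))}"
    proof (rule stationary_omega1_mono, intro subsetI)
      fix W assume "W \<in> {W \<in> omega1_subsets (H \<theta>). \<forall>k. regular k \<and> omega1 \<in> elts k \<and> elts k \<subseteq> elts \<kappa> \<and> (k = \<kappa> \<or> k \<in> W) \<longrightarrow>
        internally_approachable (W \<inter> H k) \<and>
        (\<forall>S\<in>W \<inter> \<S>. stationary_ctbl (W \<inter> H k) ((family S \<down> H k) \<inter> ctbl_subsets (W \<inter> H k)))}"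
      then have "W \<in> omega1_subsets (H \<theta>)" "internally_approachable (W \<inter> H \<kappa>)"
        "\<And>S. S \<in> W \<inter> \<S> \<Longrightarrow> stationary_ctbl (W \<inter> H \<kappa>) ((family S \<down> H \<kappa>) \<inter> ctbl_subsets (W \<inter> H \<kappa>))"
        using assms(1,2) by simp_all
      then show "W \<in> {W \<in> omega1_subsets (H \<theta>). internally_approachable (W \<inter> H \<kappa>) \<and>
         (\<forall>S\<in>W \<inter> \<S>. stationary_ctbl (W \<inter> H \<kappa>) (family S \<inter> ctbl_subsets (W \<inter> H \<kappa>)))}"
        by (simp add: whole)
    qed blast
  qed
next
  fix \<theta> assume "large_enough \<kappa> \<S> \<theta>"
  from reflection_stationary[OF assms(1,2,4) this]
  show "stationary_omega1 (H \<theta>)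
         {W \<in> omega1_subsets (H \<theta>).
            \<forall>S \<in> W \<inter> \<S>. \<forall>\<kappa>'. regular \<kappa>' \<and> \<kappa>' \<in> W \<and> elts omega2 \<subseteq> elts \<kappa>' \<and> elts \<kappa>' \<subseteq> elts \<kappa> \<longrightarrow>
              internally_approachable (W \<inter> H \<kappa>') \<and>
              stationary_ctbl (W \<inter> H \<kappa>')
                ((family S \<down> H \<kappa>') \<inter> ctbl_subsets (W \<inter> H \<kappa>'))}"
    by (rule stationary_omega1_mono) (use omega1_in_omega2[where ?'a = 'v] in blast)+
qed

end
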